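(* Let $(M_p)_{p\in\mathbb N}$ be a sequence of positive reals with $M_0=1$ satisfying $(M.1)$ and $(M.2)$, and let $(N_p)_{p\in\mathbb N}$ be a sequence of positive reals with $N_0=1$ satisfying $(M.1)$. Assume $1\prec M_p$ in statements about the class $(M_p)$ and $1\subset M_p$ in statements about the class $\{M_p\}$. For $\ast\in\{(M_p),\{M_p\}\}$ and $\dagger\in\{(N_p),\{N_p\}\}$ (where $N_p=M_p$ is also allowed), consider an associative and commutative algebra $(\Lambda^{\ast,\dagger},+,\circ)=\Lambda$ over $\mathbb C$ satisfying the following three requirements: (i) $\mathcal E_{2\pi}'^{\ast}$ is linearly embedded (i.e. via an injective linear map) into $\Lambda$, and the constant function $f(x)\equiv 1$ is the unity of $\Lambda$; (ii) for each ultradifferential operator $P(D)$ of class $\ast$ there is a linear operator $P(D):\Lambda\to\Lambda$ such that $$P(D)(e^{ikt}\circ f)=e^{ikt}\circ P(D+k)f,\qquad f\in\Lambda,\ k\in\mathbb Z,$$ and such that the restriction of $P(D)$ to $\mathcal E_{2\pi}'^{\ast}$ coincides with the usual action of $P(D)$ on $\mathcal E_{2\pi}'^{\ast}$; (iii) the restriction of $\circ$ to $\mathcal E_{2\pi}^{\dagger}\times\mathcal E_{2\pi}^{\dagger}$ coincides with the pointwise product of functions. Suppose that $M_p\prec N_p$. Then there is no associative and commutative algebra $\Lambda^{(M_p),(N_p)}$ satisfying (i)–(iii) (with $\ast=(M_p)$, $\dagger=(N_p)$), and there is no associative and commutative algebra $\Lambda^{\{M_p\},(N_p)}$ satisfying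 (i)–(iii) (with $\ast=\{M_p\}$, $\dagger=(N_p)$). Moreover, in the Beurling case there is even no associative and commutative algebra $\Lambda^{(M_p),\{M_p\}}$ satisfying (i)–(iii) (with $\ast=(M_p)$, $\dagger=\{M_p\}$).
   Context: $\mathbb N=\{0,1,2,\dots\}$, $D=-i\,d/dt$. Conditions on a positive sequence $(M_p)$: $(M.1)$: $M_p^2\le M_{p-1}M_{p+1}$ for all $p\ge 1$; $(M.2)$: there are $A,H\ge1$ with $M_{p+q}\le AH^{p+q}M_pM_q$ for all $p,q\in\mathbb N$. $M_p\subset N_p$ means that there are $C,h>0$ with $M_p\le Ch^pN_p$ for all $p$; $M_p\prec N_p$ means that for every $h>0$ there is $C>0$ with $M_p\le Ch^pN_p$ for all $p$. "$1$" denotes the constant sequence. For a positive sequence $(M_p)$ and $h>0$, $\mathcal E_{2\pi}^{M_p,h}$ is the Banach space of smooth $2\pi$-periodic functions $\varphi:\mathbb R\to\mathbb C$ with $\|\varphi\|_h=\sup_{p\in\mathbb N} h^p\|D^p\varphi\|_{L^\infty(\mathbb R)}/M_p<\infty$. Put $\mathcal E_{2\pi}^{(M_p)}=\varprojlim_{h\to\infty}\mathcal E_{2\pi}^{M_p,h}$ (intersection over all $h$, Beurling case) and $\mathcal E_{2\pi}^{\{M_p\}}=\varinjlim_{h\to0^+}\mathcal E_{2\pi}^{M_p,h}$ (union over all $h$, locally convex inductive limit, Roumieu case). The dual spaces are denoted $\mathcal E_{2\pi}'^{(M_p)}$ and $\mathcal E_{2\pi}'^{\{M_p\}}$. Smooth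 $2\pi$-periodic functions $f$ are regarded as elements of $\mathcal E_{2\pi}'^{\ast}$ via $\langle f,\varphi\rangle=\int_0^{2\pi}f(t)\varphi(t)\,dt$; through this identification and the embedding of (i), functions such as $e^{ikt}$ and elements of $\mathcal E_{2\pi}^\dagger$ are regarded as elements of $\Lambda$. An ultradifferential operator of class $(M_p)$ (of class $\{M_p\}$) is $P(D)=\sum_{n\ge0}a_nD^n$, where $P(z)=\sum_n a_nz^n$ is an entire function with $|a_n|\le CL^n/M_n$ for all $n$, for some $L,C>0$ (for every $L>0$ and some $C=C_L>0$). It acts continuously on $\mathcal E_{2\pi}^\ast$ and on $\mathcal E_{2\pi}'^\ast$ by $\langle P(D)f,\varphi\rangle=\langle f,P(-D)\varphi\rangle$. For $k\in\mathbb Z$, $P(D+k)$ is the ultradifferential operator (again of class $\ast$) with symbol $P(z+k)$. *)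

theory Defs
  imports
    "HOL-Complex_Analysis.Complex_Analysis"
    "HOL-Algebra.Algebraic_Closure_Type"
begin

section \<open>Weight sequences\<close>

definition cond_M1 :: "(nat \<Rightarrow> real) \<Rightarrow> bool" where
  "cond_M1 M \<longleftrightarrow> (\<forall>p\<ge>1. (M p)\<^sup>2 \<le> M (p - 1) * M (p + 1))"

definition cond_M2 :: "(nat \<Rightarrow> real) \<Rightarrow> bool" where
  "cond_M2 M \<longleftrightarrow> (\<exists>A\<ge>1. \<exists>H\<ge>1. \<forall>p q. M (p + q) \<le> A * H ^ (p + q) * M p * M q)"

definition seq_sub :: "(nat \<Rightarrow> real) \<Rightarrow> (nat \<Rightarrow> real) \<Rightarrow> bool" where
  "seq_sub M N \<longleftrightarrow> (\<exists>C>0. \<exists>h>0. \<forall>p. M p \<le> C * h ^ p * N p)"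

definition seq_prec :: "(nat \<Rightarrow> real) \<Rightarrow> (nat \<Rightarrow> real) \<Rightarrow> bool" where
  "seq_prec M N \<longleftrightarrow> (\<forall>h>0. \<exists>C>0. \<forall>p. M p \<le> C * h ^ p * N p)"

datatype ultra_class = Beurling "nat \<Rightarrow> real" | Roumieu "nat \<Rightarrow> real"


section \<open>Topologies defined by seminorms\<close>

definition seminorm_on ::
    "(real \<Rightarrow> complex) set \<Rightarrow> ((real \<Rightarrow> complex) \<Rightarrow> real) \<Rightarrow> bool" where
  "seminorm_on E q \<longleftrightarrow>
     (\<forall>\<phi>\<in>E. 0 \<le> q \<phi>) \<and>
     (\<forall>\<phi>\<in>E. \<forall>\<psi>\<in>E. q (\<lambda>t. \<phi> t + \<psi> t) \<le> q \<phi> + q \<psi>) \<and>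
     (\<forall>c. \<forall>\<phi>\<in>E. q (\<lambda>t. c * \<phi> t) = cmod c * q \<phi>)"

definition seminorm_topology ::
    "(real \<Rightarrow> complex) set \<Rightarrow> ((real \<Rightarrow> complex) \<Rightarrow> real) set \<Rightarrow> (real \<Rightarrow> complex) topology" where
  "seminorm_topology E Q = topology (\<lambda>U. U \<subseteq> E \<and>
     (\<forall>\<phi>\<in>U. \<exists>F e. finite F \<and> F \<subseteq> Q \<and> e > 0 \<and>
        {\<psi> \<in> E. \<forall>q\<in>F. q (\<lambda>t. \<psi> t - \<phi> t) < e} \<subseteq> U))"

lemma openin_seminorm_topology:
  "openin (seminorm_topology E Q) U \<longleftrightarrow> U \<subseteq> E \<and>
     (\<forall>\<phi>\<in>U. \<exists>F e. finite F \<and> F \<subseteq> Q \<and> e > 0 \<and>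
        {\<psi> \<in> E. \<forall>q\<in>F. q (\<lambda>t. \<psi> t - \<phi> t) < e} \<subseteq> U)"
proof -
  let ?B = "\<lambda>\<phi> F e. {\<psi> \<in> E. \<forall>q\<in>F. q (\<lambda>t. \<psi> t - \<phi> t) < (e::real)}"
  let ?P = "\<lambda>U. U \<subseteq> E \<and> (\<forall>\<phi>\<in>U. \<exists>F e. finite F \<and> F \<subseteq> Q \<and> e > 0 \<and> ?B \<phi> F e \<subseteq> U)"
  have inter: "?P (S \<inter> T)" if S: "?P S" and T: "?P T" for S T
  proof (intro conjI ballI)
    show "S \<inter> T \<subseteq> E" using S by blast
    fix \<phi> assume "\<phi> \<in> S \<inter> T"
    with S T obtain F e G d where
      F: "finite F" "F \<subseteq> Q" "e > 0" "?B \<phi> F e \<subseteq> S" and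
      G: "finite G" "G \<subseteq> Q" "d > 0" "?B \<phi> G d \<subseteq> T"
      by (meson IntD1 IntD2)
    have "?B \<phi> (F \<union> G) (min e d) \<subseteq> ?B \<phi> F e \<inter> ?B \<phi> G d" by auto
    then have "?B \<phi> (F \<union> G) (min e d) \<subseteq> S \<inter> T" using F(4) G(4) by blast
    moreover have "finite (F \<union> G)" "F \<union> G \<subseteq> Q" "min e d > 0" using F G by auto
    ultimately show "\<exists>F e. finite F \<and> F \<subseteq> Q \<and> e > 0 \<and> ?B \<phi> F e \<subseteq> S \<inter> T" by blast
  qed
  have union: "?P (\<Union>K)" if K: "\<forall>U\<in>K. ?P U" for K
  proof (intro conjI ballI)
    show "\<Union>K \<subseteq> E" using K by blast
    fix \<phi> assume "\<phi> \<in> \<Union>K"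
    then obtain U where U: "U \<in> K" "\<phi> \<in> U" by blast
    with K obtain F e where "finite F" "F \<subseteq> Q" "e > 0" "?B \<phi> F e \<subseteq> U" by meson
    moreover from this(4) U(1) have "?B \<phi> F e \<subseteq> \<Union>K" by blast
    ultimately show "\<exists>F e. finite F \<and> F \<subseteq> Q \<and> e > 0 \<and> ?B \<phi> F e \<subseteq> \<Union>K" by blast
  qed
  have "istopology ?P"
    unfolding istopology_def using inter union by simp
  then show ?thesis
    unfolding seminorm_topology_def by simp
qed


section \<open>Ultradifferentiable periodic functions\<close>

definition Dop :: "(real \<Rightarrow> complex) \<Rightarrow> real \<Rightarrow> complex" where
  "Dop \<phi> t = - \<i> * vector_derivative \<phi> (at t)"

definition smooth_periodic :: "(real \<Rightarrow> complex) set" where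
  "smooth_periodic = {\<phi>. (\<forall>p t. (Dop ^^ p) \<phi> differentiable (at t)) \<and> (\<forall>t. \<phi> (t + 2 * pi) = \<phi> t)}"

text \<open>The functions \<open>D\<^sup>p \<phi>\<close> are continuous and periodic, so the inner supremum is that of a
  bounded set and is the essential supremum.\<close>

definition scaled_sup :: "(nat \<Rightarrow> real) \<Rightarrow> real \<Rightarrow> (real \<Rightarrow> complex) \<Rightarrow> nat \<Rightarrow> real" where
  "scaled_sup M h \<phi> p = h ^ p * (SUP t. cmod ((Dop ^^ p) \<phi> t)) / M p"

definition E_step :: "(nat \<Rightarrow> real) \<Rightarrow> real \<Rightarrow> (real \<Rightarrow> complex) set" where
  "E_step M h = {\<phi> \<in> smooth_periodic. bdd_above (range (scaled_sup M h \<phi>))}"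

definition E_norm :: "(nat \<Rightarrow> real) \<Rightarrow> real \<Rightarrow> (real \<Rightarrow> complex) \<Rightarrow> real" where
  "E_norm M h \<phi> = (SUP p. scaled_sup M h \<phi> p)"

primrec E_space :: "ultra_class \<Rightarrow> (real \<Rightarrow> complex) set" where
  "E_space (Beurling M) = (\<Inter>h\<in>{0<..}. E_step M h)"
| "E_space (Roumieu M) = (\<Union>h\<in>{0<..}. E_step M h)"

text \<open>The locally convex inductive limit topology is the finest locally convex topology making all
  inclusions of the steps continuous; it is generated by all seminorms whose restrictions
  to the steps are continuous.\<close>

primrec E_seminorms :: "ultra_class \<Rightarrow> ((real \<Rightarrow> complex) \<Rightarrow> real) set" where
  "E_seminorms (Beurling M) = {E_norm M h | h. h > 0}"
| "E_seminorms (Roumieu M) = {q. seminorm_on (E_space (Roumieu M)) q \<and>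
     (\<forall>h>0. continuous_map (seminorm_topology (E_step M h) {E_norm M h}) euclideanreal q)}"

definition E_topology :: "ultra_class \<Rightarrow> (real \<Rightarrow> complex) topology" where
  "E_topology K = seminorm_topology (E_space K) (E_seminorms K)"

text \<open>Functionals are represented by total functions vanishing outside the space, so that equality
  of functionals is equality in HOL.\<close>

type_synonym functional = "(real \<Rightarrow> complex) \<Rightarrow> complex"

definition E_dual :: "ultra_class \<Rightarrow> functional set" where
  "E_dual K = {u.
     (\<forall>\<phi>\<in>E_space K. \<forall>\<psi>\<in>E_space K. u (\<lambda>t. \<phi> t + \<psi> t) = u \<phi> + u \<psi>) \<and>
     (\<forall>c. \<forall>\<phi>\<in>E_space K. u (\<lambda>t. c * \<phi> t) = c * u \<phi>) \<and>
     continuous_map (E_topology K) euclidean u \<and>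
     (\<forall>\<phi>. \<phi> \<notin> E_space K \<longrightarrow> u \<phi> = 0)}"

definition fun_functional :: "ultra_class \<Rightarrow> (real \<Rightarrow> complex) \<Rightarrow> functional" where
  "fun_functional K f =
     (\<lambda>\<phi>. if \<phi> \<in> E_space K then integral {0..2 * pi} (\<lambda>t. f t * \<phi> t) else 0)"

definition expi :: "int \<Rightarrow> real \<Rightarrow> complex" where
  "expi k t = exp (\<i> * of_int k * of_real t)"


section \<open>Ultradifferential operators\<close>

text \<open>Operators are given by their entire symbol \<open>P\<close>, whose Taylor coefficients at \<open>0\<close>
  are those of the operator.\<close>

definition taylor_coeff :: "(complex \<Rightarrow> complex) \<Rightarrow> nat \<Rightarrow> complex" where
  "taylor_coeff P n = fps_nth (fps_expansion P 0) n"

primrec ultra_symbol :: "ultra_class \<Rightarrow> (complex \<Rightarrow> complex) \<Rightarrow> bool" where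
  "ultra_symbol (Beurling M) P \<longleftrightarrow> P holomorphic_on UNIV \<and>
     (\<exists>L>0. \<exists>C>0. \<forall>n. cmod (taylor_coeff P n) \<le> C * L ^ n / M n)"
| "ultra_symbol (Roumieu M) P \<longleftrightarrow> P holomorphic_on UNIV \<and>
     (\<forall>L>0. \<exists>C>0. \<forall>n. cmod (taylor_coeff P n) \<le> C * L ^ n / M n)"

definition op_fun :: "(complex \<Rightarrow> complex) \<Rightarrow> (real \<Rightarrow> complex) \<Rightarrow> real \<Rightarrow> complex" where
  "op_fun P \<phi> t = (\<Sum>n. taylor_coeff P n * (Dop ^^ n) \<phi> t)"

definition op_dual :: "ultra_class \<Rightarrow> (complex \<Rightarrow> complex) \<Rightarrow> functional \<Rightarrow> functional" where
  "op_dual K P u = (\<lambda>\<phi>. if \<phi> \<in> E_space K then u (op_fun (\<lambda>z. P (- z)) \<phi>) else 0)"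


section \<open>Differential algebras containing the ultradistributions\<close>

abbreviation complex_ring :: "complex ring" where
  "complex_ring \<equiv> ring_of_type_algebra"

text \<open>In HOL-Algebra, an algebra is associative, commutative and unital. The qualified name
  distinguishes it from the algebras of sets.\<close>

definition linear_operator :: "(complex, 'a) module \<Rightarrow> ('a \<Rightarrow> 'a) \<Rightarrow> bool" where
  "linear_operator \<Lambda> T \<longleftrightarrow>
     T \<in> carrier \<Lambda> \<rightarrow> carrier \<Lambda> \<and>
     (\<forall>x\<in>carrier \<Lambda>. \<forall>y\<in>carrier \<Lambda>. T (x \<oplus>\<^bsub>\<Lambda>\<^esub> y) = T x \<oplus>\<^bsub>\<Lambda>\<^esub> T y) \<and>
     (\<forall>c. \<forall>x\<in>carrier \<Lambda>. T (c \<odot>\<^bsub>\<Lambda>\<^esub> x) = c \<odot>\<^bsub>\<Lambda>\<^esub> T x)"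

definition linear_embedding ::
    "ultra_class \<Rightarrow> (complex, 'a) module \<Rightarrow> (functional \<Rightarrow> 'a) \<Rightarrow> bool" where
  "linear_embedding K \<Lambda> \<iota> \<longleftrightarrow>
     \<iota> \<in> E_dual K \<rightarrow> carrier \<Lambda> \<and> inj_on \<iota> (E_dual K) \<and>
     (\<forall>u\<in>E_dual K. \<forall>v\<in>E_dual K. \<iota> (\<lambda>\<phi>. u \<phi> + v \<phi>) = \<iota> u \<oplus>\<^bsub>\<Lambda>\<^esub> \<iota> v) \<and>
     (\<forall>c. \<forall>u\<in>E_dual K. \<iota> (\<lambda>\<phi>. c * u \<phi>) = c \<odot>\<^bsub>\<Lambda>\<^esub> \<iota> u)"

text \<open>The first class is that of the ultradistributions and operators, the second one is that of the
  functions whose pointwise product is preserved. The operator on the algebra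
  assigned to the symbol \<open>P\<close> is \<open>T P\<close>.\<close>

definition optimal_algebra :: "ultra_class \<Rightarrow> ultra_class \<Rightarrow> (complex, 'a) module \<Rightarrow> bool" where
  "optimal_algebra K J \<Lambda> \<longleftrightarrow>
     Module.algebra complex_ring \<Lambda> \<and>
     (\<exists>\<iota> T.
        linear_embedding K \<Lambda> \<iota> \<and>
        \<iota> (fun_functional K (\<lambda>t. 1)) = \<one>\<^bsub>\<Lambda>\<^esub> \<and>
        (\<forall>P. ultra_symbol K P \<longrightarrow>
           linear_operator \<Lambda> (T P) \<and>
           (\<forall>k::int. \<forall>f\<in>carrier \<Lambda>.
              T P (\<iota> (fun_functional K (expi k)) \<otimes>\<^bsub>\<Lambda>\<^esub> f) =
              \<iota> (fun_functional K (expi k)) \<otimes>\<^bsub>\<Lambda>\<^esub> T (\<lambda>z. P (z + of_int k)) f) \<and>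
           (\<forall>u\<in>E_dual K. T P (\<iota> u) = \<iota> (op_dual K P u))) \<and>
        (\<forall>f\<in>E_space J. \<forall>g\<in>E_space J.
           \<iota> (fun_functional K f) \<otimes>\<^bsub>\<Lambda>\<^esub> \<iota> (fun_functional K g) =
           \<iota> (fun_functional K (\<lambda>t. f t * g t))))"

end

theory Submission
  imports Defs
begin

text \<open>The idea is Schwartz's: the geometric series \<open>v\<^sub>\<sigma> = \<Sum>n\<ge>0. e\<^bsup>i\<sigma>nt\<^esup>\<close>, \<open>\<sigma> = \<plusminus>1\<close>, are
  ultradistributions inverting \<open>1 - e\<^bsup>i\<sigma>t\<^esup>\<close>, whereas \<open>v\<^sub>1 + v\<^sub>-\<^sub>1 - 1\<close> is a nonzero multiple of the
  Dirac comb.  Choose an entire function \<open>P(z) = \<Sum>a\<^sub>n z\<^sup>n\<close> of the class of the operators with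
  \<open>a\<^sub>n > 0\<close> so large that \<open>f = \<Sum>n\<ge>0. e\<^bsup>i\<sigma>nt\<^esup> / P(n + 1)\<close> belongs to the class whose pointwise
  products are preserved.  For \<open>Q(z) = P(\<sigma>z)\<close> one has \<open>Q(D + \<sigma>) f = v\<^sub>\<sigma>\<close> and
  \<open>Q(D) (e\<^bsup>i\<sigma>t\<^esup> f) = v\<^sub>\<sigma> - 1\<close>, so the commutation rule gives \<open>v\<^sub>\<sigma> = e\<^bsup>i\<sigma>t\<^esup> \<circ> v\<^sub>\<sigma> + 1\<close> in the
  algebra.  Since the exponentials are inverse to each other, these two identities force
  \<open>v\<^sub>1 + v\<^sub>-\<^sub>1 = 1\<close>, contradicting injectivity of the embedding.\<close>

section \<open>Smooth periodic functions\<close>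

text \<open>The coefficients face opposite demands. The operator class caps \<open>a n\<close> near
  \<open>1 / M n\<close>, up to geometric factors. On the other hand every single term bounds
  \<open>P\<close> from below on the positive half-line: the term of index \<open>p + 2\<close> at
  the point \<open>n + 1\<close> controls the p-th derivative of \<open>f\<close> by
  \<open>1 / a (p + 2)\<close>, and the two surplus powers of \<open>n + 1\<close> pay for the sum
  over \<open>n\<close>. Positivity of the argument is why the series are one-sided and the symbol
  is reflected by \<sigma>. Denominators at \<open>n + 1\<close> rather than \<open>n\<close> let
  one \<open>f\<close> serve both identities: the exponential raises the frequency by \<sigma>, and
  \<open>D + \<sigma>\<close> moves the symbol by the same amount. For Beurling operators
  \<open>a n = 1 / M n\<close> is admissible, and (M.2) absorbs the shift by two even within the
  Roumieu class of \<open>M\<close>. Roumieu operators require coefficients below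
  \<open>1 / M n\<close> by every geometric factor; this loss is paid out of the gap between
  \<open>M\<close> and \<open>N\<close> through a geometric mean. (M.1) keeps translated symbols in
  their class, (M.2) lets operators act on test functions.\<close>

definition Dsup :: "nat \<Rightarrow> (real \<Rightarrow> complex) \<Rightarrow> real" where
  "Dsup p \<phi> = (SUP t. cmod ((Dop ^^ p) \<phi> t))"

lemma Dop_has_vector_derivative:
  assumes "\<phi> \<in> smooth_periodic"
  shows "((Dop ^^ p) \<phi> has_vector_derivative \<i> * (Dop ^^ Suc p) \<phi> t) (at t)"
proof -
  have "(Dop ^^ p) \<phi> differentiable (at t)"
    using assms by (simp add: smooth_periodic_def)
  then show ?thesis
    by (simp add: Dop_def vector_derivative_works)
qed

lemma Dop_eq: "(f has_vector_derivative \<i> * d) (at t) \<Longrightarrow> Dop f t = d"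
  by (simp add: Dop_def vector_derivative_at)

lemma continuous_Dop:
  assumes "\<phi> \<in> smooth_periodic"
  shows "continuous_on A ((Dop ^^ p) \<phi>)"
  using Dop_has_vector_derivative[OF assms]
  by (meson continuous_at_imp_continuous_on has_vector_derivative_continuous)

lemma periodic_Dop:
  assumes "\<phi> \<in> smooth_periodic"
  shows "(Dop ^^ p) \<phi> (t + 2 * pi) = (Dop ^^ p) \<phi> t"
proof (induction p arbitrary: t)
  case 0
  then show ?case using assms by (simp add: smooth_periodic_def)
next
  case (Suc p)
  have "((\<lambda>t. (Dop ^^ p) \<phi> (t + 2 * pi)) has_vector_derivative \<i> * (Dop ^^ Suc p) \<phi> (t + 2 * pi)) (at t)"
    using vector_diff_chain_at[of "\<lambda>t. t + 2 * pi" 1 t "(Dop ^^ p) \<phi>"]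
      Dop_has_vector_derivative[OF assms, of p "t + 2 * pi"]
    by (simp add: o_def has_vector_derivative_def has_derivative_ident has_derivative_add_const)
  then have "Dop ((Dop ^^ p) \<phi>) t = (Dop ^^ Suc p) \<phi> (t + 2 * pi)"
    unfolding Suc.IH by (rule Dop_eq)
  then show ?case by simp
qed

lemma periodic_shift:
  assumes "\<And>t::real. g (t + 2 * pi) = g t"
  shows "g (t + 2 * pi * of_int k) = g t"
proof -
  have nat: "g (s + 2 * pi * of_nat n) = g s" for s n
  proof (induction n)
    case (Suc n)
    have "g (s + 2 * pi * of_nat (Suc n)) = g ((s + 2 * pi * of_nat n) + 2 * pi)"
      by (simp add: algebra_simps)
    then show ?case using assms Suc by metis
  qed simp
  show ?thesis
  proof (cases "k \<ge> 0")
    case True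
    then show ?thesis using nat[of t "nat k"] by simp
  next
    case False
    then show ?thesis using nat[of "t + 2 * pi * of_int k" "nat (- k)"] by simp
  qed
qed

text \<open>\<open>SUP\<close> dominates a family only if that family is bounded. Reducing
  \<open>t\<close> to one period supplies the bound, so that \<open>Dsup\<close> really dominates
  every value of the derivative.\<close>

lemma periodic_bounded:
  fixes g :: "real \<Rightarrow> complex"
  assumes "continuous_on {0..2 * pi} g" and per: "\<And>t. g (t + 2 * pi) = g t"
  shows "bdd_above (range (\<lambda>t. cmod (g t)))"
proof -
  have "compact (g ` {0..2 * pi})"
    using assms(1) by (intro compact_continuous_image) auto
  then obtain B where B: "\<And>t. t \<in> {0..2 * pi} \<Longrightarrow> cmod (g t) \<le> B"
    using compact_imp_bounded bounded_iff by (metis image_eqI)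
  have "cmod (g t) \<le> B" for t
  proof -
    define k where "k = \<lfloor>t / (2 * pi)\<rfloor>"
    have "of_int k \<le> t / (2 * pi)" "t / (2 * pi) \<le> of_int k + 1"
      unfolding k_def by linarith+
    then have "t + 2 * pi * of_int (- k) \<in> {0..2 * pi}"
      by (simp add: field_simps)
    from B[OF this] show ?thesis
      unfolding periodic_shift[of g, OF per] .
  qed
  then show ?thesis by (auto intro!: bdd_aboveI)
qed

lemma Dop_le_Dsup:
  assumes "\<phi> \<in> smooth_periodic"
  shows "cmod ((Dop ^^ p) \<phi> t) \<le> Dsup p \<phi>"
  unfolding Dsup_def
  by (intro cSUP_upper periodic_bounded continuous_Dop periodic_Dop assms) simp

lemma Dsup_nonneg: "\<phi> \<in> smooth_periodic \<Longrightarrow> 0 \<le> Dsup p \<phi>"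
  by (rule order_trans[OF norm_ge_zero Dop_le_Dsup])

lemma Dsup_least: "(\<And>t. cmod ((Dop ^^ p) \<phi> t) \<le> B) \<Longrightarrow> Dsup p \<phi> \<le> B"
  unfolding Dsup_def by (rule cSUP_least) auto

lemma Dop_pow_add:
  assumes "\<phi> \<in> smooth_periodic" "\<psi> \<in> smooth_periodic"
  shows "(Dop ^^ p) (\<lambda>t. \<phi> t + \<psi> t) = (\<lambda>t. (Dop ^^ p) \<phi> t + (Dop ^^ p) \<psi> t)"
proof (induction p)
  case (Suc p)
  have "Dop ((Dop ^^ p) (\<lambda>t. \<phi> t + \<psi> t)) t = (Dop ^^ Suc p) \<phi> t + (Dop ^^ Suc p) \<psi> t" for t
    unfolding Suc
    by (rule Dop_eq)
      (use has_vector_derivative_add[OF Dop_has_vector_derivative[OF assms(1), of p t]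
          Dop_has_vector_derivative[OF assms(2), of p t]]
        in \<open>simp add: distrib_left\<close>)
  then show ?case by auto
qed simp

lemma Dop_pow_cmult:
  assumes "\<phi> \<in> smooth_periodic"
  shows "(Dop ^^ p) (\<lambda>t. c * \<phi> t) = (\<lambda>t. c * (Dop ^^ p) \<phi> t)"
proof (induction p)
  case (Suc p)
  have "Dop ((Dop ^^ p) (\<lambda>t. c * \<phi> t)) t = c * (Dop ^^ Suc p) \<phi> t" for t
    unfolding Suc
    by (rule Dop_eq)
      (use has_vector_derivative_mult_right[OF Dop_has_vector_derivative[OF assms, of p t], of c]
        in \<open>simp add: mult_ac\<close>)
  then show ?case by auto
qed simp

lemma smooth_periodic_add:
  assumes "\<phi> \<in> smooth_periodic" "\<psi> \<in> smooth_periodic"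
  shows "(\<lambda>t. \<phi> t + \<psi> t) \<in> smooth_periodic"
  using assms by (auto simp: smooth_periodic_def Dop_pow_add[OF assms])

lemma smooth_periodic_cmult:
  assumes "\<phi> \<in> smooth_periodic"
  shows "(\<lambda>t. c * \<phi> t) \<in> smooth_periodic"
  using assms by (auto simp: smooth_periodic_def Dop_pow_cmult[OF assms])

lemma Dsup_add:
  assumes "\<phi> \<in> smooth_periodic" "\<psi> \<in> smooth_periodic"
  shows "Dsup p (\<lambda>t. \<phi> t + \<psi> t) \<le> Dsup p \<phi> + Dsup p \<psi>"
proof (rule Dsup_least)
  show "cmod ((Dop ^^ p) (\<lambda>t. \<phi> t + \<psi> t) t) \<le> Dsup p \<phi> + Dsup p \<psi>" for t
    unfolding Dop_pow_add[OF assms]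
    using norm_triangle_ineq add_mono[OF Dop_le_Dsup[OF assms(1)] Dop_le_Dsup[OF assms(2)]]
    by (rule order_trans)
qed

lemma Dsup_cmult:
  assumes "\<phi> \<in> smooth_periodic"
  shows "Dsup p (\<lambda>t. c * \<phi> t) \<le> cmod c * Dsup p \<phi>"
  by (rule Dsup_least)
    (simp add: Dop_pow_cmult[OF assms] norm_mult mult_left_mono Dop_le_Dsup[OF assms])

section \<open>Membership in the classes through bounds on derivatives\<close>

lemma E_step_iff:
  assumes "\<And>p. M p > 0"
  shows "\<phi> \<in> E_step M h \<longleftrightarrow> \<phi> \<in> smooth_periodic \<and> (\<exists>B. \<forall>p. h ^ p * Dsup p \<phi> \<le> B * M p)"
  using assms
  by (auto simp: E_step_def bdd_above_def scaled_sup_def Dsup_def pos_divide_le_eq)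

lemma E_step_mono:
  assumes "\<And>p. M p > 0" "0 < h" "h \<le> k"
  shows "E_step M k \<subseteq> E_step M h"
proof
  fix \<phi> assume "\<phi> \<in> E_step M k"
  then obtain B where \<phi>: "\<phi> \<in> smooth_periodic" and B: "\<And>p. k ^ p * Dsup p \<phi> \<le> B * M p"
    unfolding E_step_iff[OF assms(1)] by blast
  have "h ^ p * Dsup p \<phi> \<le> B * M p" for p
  proof -
    have "h ^ p * Dsup p \<phi> \<le> k ^ p * Dsup p \<phi>"
      using assms Dsup_nonneg[OF \<phi>] by (intro mult_right_mono power_mono) auto
    then show ?thesis using B[of p] by linarith
  qed
  with \<phi> show "\<phi> \<in> E_step M h" unfolding E_step_iff[OF assms(1)] by blast
qed

lemma E_step_add:
  assumes "\<And>p. M p > 0" "0 < h" "\<phi> \<in> E_step M h" "\<psi> \<in> E_step M h"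
  shows "(\<lambda>t. \<phi> t + \<psi> t) \<in> E_step M h"
proof -
  from assms(3,4) obtain B C
    where \<phi>: "\<phi> \<in> smooth_periodic" and B: "\<And>p. h ^ p * Dsup p \<phi> \<le> B * M p"
      and \<psi>: "\<psi> \<in> smooth_periodic" and C: "\<And>p. h ^ p * Dsup p \<psi> \<le> C * M p"
    unfolding E_step_iff[OF assms(1)] by blast
  have "h ^ p * Dsup p (\<lambda>t. \<phi> t + \<psi> t) \<le> (B + C) * M p" for p
  proof -
    have "h ^ p * Dsup p (\<lambda>t. \<phi> t + \<psi> t) \<le> h ^ p * (Dsup p \<phi> + Dsup p \<psi>)"
      using assms Dsup_add[OF \<phi> \<psi>] by (intro mult_left_mono) auto
    then show ?thesis using B[of p] C[of p] by (simp add: distrib_left distrib_right)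
  qed
  then show ?thesis
    using smooth_periodic_add[OF \<phi> \<psi>] unfolding E_step_iff[OF assms(1)] by blast
qed

lemma E_step_cmult:
  assumes "\<And>p. M p > 0" "0 < h" "\<phi> \<in> E_step M h"
  shows "(\<lambda>t. c * \<phi> t) \<in> E_step M h"
proof -
  from assms(3) obtain B
    where \<phi>: "\<phi> \<in> smooth_periodic" and B: "\<And>p. h ^ p * Dsup p \<phi> \<le> B * M p"
    unfolding E_step_iff[OF assms(1)] by blast
  have "h ^ p * Dsup p (\<lambda>t. c * \<phi> t) \<le> (cmod c * B) * M p" for p
  proof -
    have "h ^ p * Dsup p (\<lambda>t. c * \<phi> t) \<le> h ^ p * (cmod c * Dsup p \<phi>)"
      using assms Dsup_cmult[OF \<phi>] by (intro mult_left_mono) auto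
    also have "\<dots> = cmod c * (h ^ p * Dsup p \<phi>)" by simp
    also have "\<dots> \<le> cmod c * (B * M p)"
      using B by (intro mult_left_mono) auto
    finally show ?thesis by (simp add: mult.assoc)
  qed
  then show ?thesis
    using smooth_periodic_cmult[OF \<phi>] unfolding E_step_iff[OF assms(1)] by blast
qed

lemma Dsup_le_E_norm:
  assumes "\<And>p. M p > 0" "h > 0" "\<phi> \<in> E_step M h"
  shows "Dsup p \<phi> \<le> M p / h ^ p * E_norm M h \<phi>"
proof -
  have "scaled_sup M h \<phi> p \<le> E_norm M h \<phi>"
    using assms(3) unfolding E_norm_def by (intro cSUP_upper) (auto simp: E_step_def)
  then show ?thesis
    using assms(1)[of p] assms(2) unfolding scaled_sup_def Dsup_def[symmetric]
    by (simp add: field_simps)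
qed

text \<open>Forgets which of the two classes is meant, so that hypotheses on the sequence are stated
  once for both.\<close>

fun weight :: "ultra_class \<Rightarrow> nat \<Rightarrow> real" where
  "weight (Beurling M) = M"
| "weight (Roumieu M) = M"

lemma E_space_E_stepE:
  assumes "\<phi> \<in> E_space K"
  obtains h where "h > 0" "\<phi> \<in> E_step (weight K) h"
  using assms by (cases K) (auto intro: that[of 1])

lemma E_space_smooth_periodic: "\<phi> \<in> E_space K \<Longrightarrow> \<phi> \<in> smooth_periodic"
  by (erule E_space_E_stepE) (simp add: E_step_def)

lemma E_space_add:
  assumes pos: "\<And>p. weight K p > 0" and "\<phi> \<in> E_space K" "\<psi> \<in> E_space K"
  shows "(\<lambda>t. \<phi> t + \<psi> t) \<in> E_space K"
proof (cases K)
  case (Beurling M)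
  then show ?thesis using assms by (auto intro: E_step_add)
next
  case (Roumieu M)
  then obtain h k where hk: "h > 0" "\<phi> \<in> E_step M h" "k > 0" "\<psi> \<in> E_step M k"
    using assms(2,3) by auto
  have pos': "\<And>p. M p > 0" using pos Roumieu by simp
  \<comment> \<open>Steps shrink as the parameter grows, so the smaller parameter gives a common
    step.\<close>
  have "\<phi> \<in> E_step M (min h k)" "\<psi> \<in> E_step M (min h k)"
    using hk E_step_mono[OF pos', of "min h k"] by (meson min.cobounded1 min.cobounded2 min_less_iff_conj subsetD)+
  then have "(\<lambda>t. \<phi> t + \<psi> t) \<in> E_step M (min h k)"
    using hk by (intro E_step_add pos') auto
  moreover have "min h k \<in> {0<..}" using hk by simp
  ultimately show ?thesis unfolding Roumieu E_space.simps by blast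
qed

lemma E_space_cmult:
  assumes pos: "\<And>p. weight K p > 0" and "\<phi> \<in> E_space K"
  shows "(\<lambda>t. c * \<phi> t) \<in> E_space K"
  using assms by (cases K) (auto intro: E_step_cmult)

section \<open>Continuity of functionals\<close>

lemma topspace_seminorm_topology: "topspace (seminorm_topology E Q) = E"
proof -
  have "openin (seminorm_topology E Q) E"
    unfolding openin_seminorm_topology
    by (metis (no_types, lifting) empty_subsetI finite.emptyI mem_Collect_eq subsetI zero_less_one)
  then show ?thesis
    by (metis openin_seminorm_topology openin_subset openin_topspace subset_antisym)
qed

text \<open>A Lipschitz estimate by one seminorm of the family suffices. The target is a general
  metric space because both complex functionals and real-valued seminorms are treated.\<close>

lemma continuous_map_seminorm_topology:
  fixes u :: "(real \<Rightarrow> complex) \<Rightarrow> 'b::metric_space"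
  assumes "q \<in> Q" "C \<ge> 0"
    and bound: "\<And>\<phi> \<psi>. \<phi> \<in> E \<Longrightarrow> \<psi> \<in> E \<Longrightarrow> dist (u \<psi>) (u \<phi>) \<le> C * q (\<lambda>t. \<psi> t - \<phi> t)"
  shows "continuous_map (seminorm_topology E Q) euclidean u"
  unfolding continuous_map_def topspace_seminorm_topology
proof (intro conjI allI impI)
  fix U :: "'b set" assume U: "openin euclidean U"
  show "openin (seminorm_topology E Q) {\<phi> \<in> E. u \<phi> \<in> U}"
    unfolding openin_seminorm_topology
  proof (intro conjI ballI)
    fix \<phi> assume \<phi>: "\<phi> \<in> {\<phi> \<in> E. u \<phi> \<in> U}"
    with U obtain e where e: "e > 0" "\<And>y. dist y (u \<phi>) < e \<Longrightarrow> y \<in> U"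
      by (auto simp: open_dist)
    \<comment> \<open>The summand 1 keeps the quotient meaningful and the estimate strict when
      \<open>C = 0\<close>.\<close>
    define d where "d = e / (1 + C)"
    have d: "d > 0" "C * d < e" using e(1) \<open>C \<ge> 0\<close> by (auto simp: d_def field_simps)
    have "u \<psi> \<in> U" if "\<psi> \<in> E" "q (\<lambda>t. \<psi> t - \<phi> t) < d" for \<psi>
    proof (rule e(2))
      have "dist (u \<psi>) (u \<phi>) \<le> C * q (\<lambda>t. \<psi> t - \<phi> t)" using \<phi> that bound by blast
      also have "\<dots> \<le> C * d" using that \<open>C \<ge> 0\<close> by (intro mult_left_mono) auto
      finally show "dist (u \<psi>) (u \<phi>) < e" using d by linarith
    qed
    then show "\<exists>F e. finite F \<and> F \<subseteq> Q \<and> 0 < e \<and>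
        {\<psi> \<in> E. \<forall>q\<in>F. q (\<lambda>t. \<psi> t - \<phi> t) < e} \<subseteq> {\<phi> \<in> E. u \<phi> \<in> U}"
      using assms(1) d(1) by (intro exI[of _ "{q}"] exI[of _ d]) auto
  qed auto
qed auto

text \<open>The zeroth and second derivatives suffice to dominate the Fourier series occurring here.\<close>

lemma E_dualI:
  assumes pos: "\<And>p. weight K p > 0"
    and add: "\<And>\<phi> \<psi>. \<phi> \<in> E_space K \<Longrightarrow> \<psi> \<in> E_space K \<Longrightarrow> u (\<lambda>t. \<phi> t + \<psi> t) = u \<phi> + u \<psi>"
    and cmult: "\<And>c \<phi>. \<phi> \<in> E_space K \<Longrightarrow> u (\<lambda>t. c * \<phi> t) = c * u \<phi>"
    and zero: "\<And>\<phi>. \<phi> \<notin> E_space K \<Longrightarrow> u \<phi> = 0"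
    and bound: "\<And>\<phi>. \<phi> \<in> E_space K \<Longrightarrow> cmod (u \<phi>) \<le> B * (Dsup 0 \<phi> + Dsup 2 \<phi>)"
    and "B \<ge> 0"
  shows "u \<in> E_dual K"
proof -
  have diff_closed: "(\<lambda>t. \<psi> t - \<phi> t) \<in> E_space K"
    and diff: "u (\<lambda>t. \<psi> t - \<phi> t) = u \<psi> - u \<phi>"
    if "\<phi> \<in> E_space K" "\<psi> \<in> E_space K" for \<phi> \<psi>
    using E_space_add[OF pos that(2) E_space_cmult[OF pos that(1), of "-1"]]
      add[OF that(2) E_space_cmult[OF pos that(1), of "-1"]] cmult[OF that(1), of "-1"]
    by simp_all
  have step: "cmod (u \<phi>) \<le> B * (weight K 0 + weight K 2 / h\<^sup>2) * E_norm (weight K) h \<phi>"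
    if "h > 0" "\<phi> \<in> E_step (weight K) h" "\<phi> \<in> E_space K" for h \<phi>
  proof -
    have "Dsup 0 \<phi> + Dsup 2 \<phi> \<le> (weight K 0 + weight K 2 / h\<^sup>2) * E_norm (weight K) h \<phi>"
      using Dsup_le_E_norm[OF pos that(1,2), of 0] Dsup_le_E_norm[OF pos that(1,2), of 2]
      by (simp add: distrib_right)
    then have "B * (Dsup 0 \<phi> + Dsup 2 \<phi>) \<le> B * ((weight K 0 + weight K 2 / h\<^sup>2) * E_norm (weight K) h \<phi>)"
      using \<open>B \<ge> 0\<close> by (rule mult_left_mono)
    with bound[OF that(3)] show ?thesis by (simp add: mult.assoc)
  qed
  have const: "B * (weight K 0 + weight K 2 / h\<^sup>2) \<ge> 0" for h
    using \<open>B \<ge> 0\<close> pos[of 0] pos[of 2] by simp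
  have "continuous_map (E_topology K) euclidean u"
  proof (cases K)
    case (Beurling M)
    show ?thesis
      unfolding E_topology_def
    proof (rule continuous_map_seminorm_topology[OF _ const[of 1]])
      \<comment> \<open>A single norm of the projective family is enough; the parameter 1 is
        arbitrary.\<close>
      show "E_norm (weight K) 1 \<in> E_seminorms K" using Beurling by auto
      fix \<phi> \<psi> assume "\<phi> \<in> E_space K" "\<psi> \<in> E_space K"
      then show "dist (u \<psi>) (u \<phi>)
          \<le> B * (weight K 0 + weight K 2 / 1\<^sup>2) * E_norm (weight K) 1 (\<lambda>t. \<psi> t - \<phi> t)"
        using step[of 1 "\<lambda>t. \<psi> t - \<phi> t"] diff diff_closed Beurling by (auto simp: dist_norm)
    qed
  next
    case (Roumieu M)
    \<comment> \<open>The modulus of \<open>u\<close> is itself a seminorm that is continuous on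
      every step, hence one of the seminorms generating the inductive limit topology; with respect
      to it \<open>u\<close> is Lipschitz with constant 1.\<close>
    let ?q = "\<lambda>\<phi>. cmod (u \<phi>)"
    have posM: "\<And>p. M p > 0" using pos Roumieu by simp
    have "continuous_map (seminorm_topology (E_step M h) {E_norm M h}) euclideanreal ?q" if "h > 0" for h
    proof (rule continuous_map_seminorm_topology[OF _ const[of h]])
      fix \<phi> \<psi> assume A: "\<phi> \<in> E_step M h" "\<psi> \<in> E_step M h"
      have E: "\<phi> \<in> E_space K" "\<psi> \<in> E_space K" using A that Roumieu by auto
      have "(\<lambda>t. \<psi> t - \<phi> t) \<in> E_step M h"
        using E_step_add[OF posM that A(2) E_step_cmult[OF posM that A(1), of "-1"]] by simp
      then have "cmod (u \<psi> - u \<phi>) \<le> B * (weight K 0 + weight K 2 / h\<^sup>2) * E_norm M h (\<lambda>t. \<psi> t - \<phi> t)"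
        using step[of h "\<lambda>t. \<psi> t - \<phi> t"] that diff[OF E] diff_closed[OF E] Roumieu by simp
      then show "dist (?q \<psi>) (?q \<phi>) \<le> B * (weight K 0 + weight K 2 / h\<^sup>2) * E_norm M h (\<lambda>t. \<psi> t - \<phi> t)"
        using norm_triangle_ineq3[of "u \<psi>" "u \<phi>"] by (simp add: dist_real_def)
    qed simp
    moreover have "seminorm_on (E_space K) ?q"
      unfolding seminorm_on_def by (auto simp: add cmult norm_mult norm_triangle_ineq)
    ultimately have "?q \<in> E_seminorms K" using Roumieu by simp
    then show ?thesis
      unfolding E_topology_def
      by (rule continuous_map_seminorm_topology[where C = 1])
        (auto simp: dist_norm diff)
  qed
  then show ?thesis
    unfolding E_dual_def using add cmult zero by blast
qed

text \<open>The scalar covers both uses at once: \<open>c = -1\<close> for a geometric series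
  without its constant term, \<open>c = 1\<close> for the sum of the two geometric series.\<close>

lemma E_dual_add_cmult:
  assumes u: "u \<in> E_dual K" and v: "v \<in> E_dual K"
  shows "(\<lambda>\<phi>. u \<phi> + c * v \<phi>) \<in> E_dual K"
proof -
  have "continuous_map (E_topology K) euclidean ((\<lambda>z. c * z) \<circ> v)"
    using v by (intro continuous_map_compose[of _ euclidean])
      (auto simp: E_dual_def intro!: continuous_intros)
  then have "continuous_map (E_topology K) euclidean (\<lambda>\<phi>. u \<phi> + c * v \<phi>)"
    using u by (intro continuous_map_add) (auto simp: E_dual_def o_def)
  with u v show ?thesis
    by (auto simp: E_dual_def algebra_simps)
qed

section \<open>Series of smooth periodic functions\<close>

lemma integral_suminf:
  fixes g :: "nat \<Rightarrow> real \<Rightarrow> complex"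
  assumes cont: "\<And>n. continuous_on {a..b} (g n)"
    and le: "\<And>n t. t \<in> {a..b} \<Longrightarrow> cmod (g n t) \<le> B n" and "summable B"
  shows "(\<lambda>n. integral {a..b} (g n)) sums integral {a..b} (\<lambda>t. \<Sum>n. g n t)"
proof -
  have "uniform_limit {a..b} (\<lambda>N t. \<Sum>n<N. g n t) (\<lambda>t. \<Sum>n. g n t) sequentially"
    using le \<open>summable B\<close> by (rule Weierstrass_m_test)
  then obtain I J where I: "\<And>N. ((\<lambda>t. \<Sum>n<N. g n t) has_integral I N) {a..b}"
    and J: "((\<lambda>t. \<Sum>n. g n t) has_integral J) {a..b}" and lim: "I \<longlonglongrightarrow> J"
    by (rule uniform_limit_integral) (auto intro!: continuous_intros cont)
  have "I N = (\<Sum>n<N. integral {a..b} (g n))" for N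
    using integral_unique[OF I[of N]] integrable_continuous_interval[OF cont]
    by (simp add: integral_sum)
  then have "I = (\<lambda>N. \<Sum>n<N. integral {a..b} (g n))" by blast
  with lim J show ?thesis
    unfolding sums_def by (simp add: integral_unique)
qed

text \<open>The Weierstrass test makes the series of derivatives converge uniformly on the whole
  line, which is what differentiation term by term requires.\<close>

lemma Dop_suminf:
  assumes smooth: "\<And>n. g n \<in> smooth_periodic"
    and sum: "summable (\<lambda>n. Dsup p (g n))" "summable (\<lambda>n. Dsup (Suc p) (g n))"
  shows "((\<lambda>t. \<Sum>n. (Dop ^^ p) (g n) t) has_vector_derivative \<i> * (\<Sum>n. (Dop ^^ Suc p) (g n) t)) (at t)"
proof -
  let ?d = "\<lambda>n x. \<i> * (Dop ^^ Suc p) (g n) x"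
  let ?D = "\<lambda>x. \<Sum>n. ?d n x"
  have summable: "summable (\<lambda>n. (Dop ^^ q) (g n) x)" if "summable (\<lambda>n. Dsup q (g n))" for q x
    using that by (rule summable_comparison_test') (rule Dop_le_Dsup[OF smooth])
  have ulim: "uniform_limit UNIV (\<lambda>N x. \<Sum>n<N. ?d n x) ?D sequentially"
    by (rule Weierstrass_m_test[OF _ sum(2)])
      (simp add: norm_mult Dop_le_Dsup[OF smooth, of "Suc p", simplified])
  have "\<exists>G. \<forall>x\<in>UNIV. (\<lambda>n. (Dop ^^ p) (g n) x) sums G x \<and>
          (G has_derivative (\<lambda>h. h *\<^sub>R ?D x)) (at x within UNIV)"
  proof (rule has_derivative_series)
    fix n x
    show "((Dop ^^ p) (g n) has_derivative (\<lambda>h. h *\<^sub>R ?d n x)) (at x within UNIV)"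
      using Dop_has_vector_derivative[OF smooth] unfolding has_vector_derivative_def .
  next
    fix e :: real assume "e > 0"
    with ulim have "\<forall>\<^sub>F N in sequentially. \<forall>x\<in>UNIV. dist (\<Sum>n<N. ?d n x) (?D x) < e"
      by (auto simp: uniform_limit_iff)
    then show "\<forall>\<^sub>F N in sequentially. \<forall>x\<in>UNIV. \<forall>h.
        norm ((\<Sum>n<N. h *\<^sub>R ?d n x) - h *\<^sub>R ?D x) \<le> e * norm h"
    proof eventually_elim
      case (elim N)
      show ?case
      proof (intro ballI allI)
        fix x h :: real
        have "(\<Sum>n<N. h *\<^sub>R ?d n x) - h *\<^sub>R ?D x = h *\<^sub>R ((\<Sum>n<N. ?d n x) - ?D x)"
          by (simp only: scaleR_diff_right scaleR_sum_right)
        then have "norm ((\<Sum>n<N. h *\<^sub>R ?d n x) - h *\<^sub>R ?D x) = \<bar>h\<bar> * dist (\<Sum>n<N. ?d n x) (?D x)"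
          by (simp only: norm_scaleR dist_norm real_norm_def)
        also have "\<dots> \<le> \<bar>h\<bar> * e"
          by (rule mult_left_mono[OF less_imp_le[OF bspec[OF elim UNIV_I]] abs_ge_zero])
        finally show "norm ((\<Sum>n<N. h *\<^sub>R ?d n x) - h *\<^sub>R ?D x) \<le> e * norm h"
          by (simp add: mult.commute)
      qed
    qed
  next
    \<comment> \<open>For the undifferentiated series, convergence at one point is all that the
      theorem asks.\<close>
    show "(\<lambda>n. (Dop ^^ p) (g n) 0) sums (\<Sum>n. (Dop ^^ p) (g n) 0)"
      using summable[OF sum(1)] by (rule summable_sums)
  qed auto
  then obtain G where G: "\<And>x. (\<lambda>n. (Dop ^^ p) (g n) x) sums G x"
    "\<And>x. (G has_derivative (\<lambda>h. h *\<^sub>R ?D x)) (at x)"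
    by auto
  have "G = (\<lambda>t. \<Sum>n. (Dop ^^ p) (g n) t)"
    using G(1) by (auto simp: sums_iff)
  moreover have "?D t = \<i> * (\<Sum>n. (Dop ^^ Suc p) (g n) t)"
    using summable[OF sum(2)] by (rule suminf_mult)
  ultimately show ?thesis
    using G(2)[of t] by (simp add: has_vector_derivative_def)
qed

lemma Dop_pow_suminf:
  assumes smooth: "\<And>n. g n \<in> smooth_periodic" and sum: "\<And>p. summable (\<lambda>n. Dsup p (g n))"
  shows "(Dop ^^ p) (\<lambda>t. \<Sum>n. g n t) = (\<lambda>t. \<Sum>n. (Dop ^^ p) (g n) t)"
proof (induction p)
  case (Suc p)
  have "Dop ((Dop ^^ p) (\<lambda>t. \<Sum>n. g n t)) t = (\<Sum>n. (Dop ^^ Suc p) (g n) t)" for t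
    unfolding Suc by (rule Dop_eq, rule Dop_suminf) (rule smooth sum)+
  then show ?case by auto
qed simp

lemma smooth_periodic_suminf:
  assumes smooth: "\<And>n. g n \<in> smooth_periodic" and sum: "\<And>p. summable (\<lambda>n. Dsup p (g n))"
  shows "(\<lambda>t. \<Sum>n. g n t) \<in> smooth_periodic"
    and "Dsup p (\<lambda>t. \<Sum>n. g n t) \<le> (\<Sum>n. Dsup p (g n))"
proof -
  have "g n (t + 2 * pi) = g n t" for n t
    using smooth by (simp add: smooth_periodic_def)
  moreover have "(\<lambda>t. \<Sum>n. (Dop ^^ p) (g n) t) differentiable (at t)" for p t
    using Dop_suminf[OF smooth sum sum] by (rule differentiableI_vector)
  ultimately show "(\<lambda>t. \<Sum>n. g n t) \<in> smooth_periodic"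
    by (simp add: smooth_periodic_def Dop_pow_suminf[OF smooth sum])
  show "Dsup p (\<lambda>t. \<Sum>n. g n t) \<le> (\<Sum>n. Dsup p (g n))"
  proof (rule Dsup_least)
    fix t
    have le: "cmod ((Dop ^^ p) (g n) t) \<le> Dsup p (g n)" for n
      by (rule Dop_le_Dsup[OF smooth])
    have s: "summable (\<lambda>n. cmod ((Dop ^^ p) (g n) t))"
      by (rule summable_comparison_test'[OF sum[of p]]) (simp add: le)
    then have "cmod (\<Sum>n. (Dop ^^ p) (g n) t) \<le> (\<Sum>n. cmod ((Dop ^^ p) (g n) t))"
      by (rule summable_norm)
    also have "\<dots> \<le> (\<Sum>n. Dsup p (g n))"
      using le s sum by (rule suminf_le)
    finally show "cmod ((Dop ^^ p) (\<lambda>t. \<Sum>n. g n t) t) \<le> (\<Sum>n. Dsup p (g n))"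
      by (simp add: Dop_pow_suminf[OF smooth sum])
  qed
qed

lemma smooth_periodic_Dop_pow: "\<phi> \<in> smooth_periodic \<Longrightarrow> (Dop ^^ n) \<phi> \<in> smooth_periodic"
  using periodic_Dop[of \<phi> n]
  by (simp add: smooth_periodic_def flip: funpow_add[unfolded o_def, THEN fun_cong])

lemma Dsup_Dop_pow: "Dsup p ((Dop ^^ n) \<phi>) = Dsup (p + n) \<phi>"
  by (simp add: Dsup_def funpow_add)

section \<open>Fourier coefficients\<close>

lemma expi_add: "expi k t * expi l t = expi (k + l) t"
  by (simp add: expi_def exp_add[symmetric] algebra_simps)

lemma expi_0: "expi 0 = (\<lambda>t. 1)"
  by (simp add: expi_def fun_eq_iff)

lemma norm_expi [simp]: "cmod (expi k t) = 1"
proof -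
  have "expi k t = exp (\<i> * of_real (of_int k * t))" by (simp add: expi_def mult.assoc)
  then show ?thesis by (simp only: norm_exp_i_times)
qed

lemma expi_periodic: "expi k (t + 2 * pi) = expi k t"
proof -
  have "expi k (t + 2 * pi) = expi k t * exp (2 * of_int k * of_real pi * \<i>)"
    by (simp add: expi_def exp_add[symmetric] algebra_simps)
  then show ?thesis using exp_integer_2pi[of "of_int k"] by simp
qed

lemma expi_has_vector_derivative:
  "(expi k has_vector_derivative \<i> * (of_int k * expi k t)) (at t)"
  unfolding expi_def[abs_def]
  by (rule has_vector_derivative_real_field[where f = "\<lambda>z. exp (\<i> * of_int k * z)"])
    (auto intro!: derivative_eq_intros)

lemma Dop_pow_expi: "(Dop ^^ p) (expi k) = (\<lambda>t. of_int k ^ p * expi k t)"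
proof (induction p)
  case (Suc p)
  have "Dop (\<lambda>t. of_int k ^ p * expi k t) t = of_int k ^ Suc p * expi k t" for t
    by (rule Dop_eq)
      (use has_vector_derivative_mult_right[OF expi_has_vector_derivative[of k t], of "of_int k ^ p"]
        in \<open>simp add: mult_ac\<close>)
  then show ?case using Suc by auto
qed simp

lemma smooth_periodic_expi: "expi k \<in> smooth_periodic"
  unfolding smooth_periodic_def Dop_pow_expi
  by (auto simp: Dop_pow_expi expi_periodic
      intro: differentiableI_vector has_vector_derivative_mult_right expi_has_vector_derivative)

lemma Dsup_expi: "Dsup p (expi k) = \<bar>of_int k\<bar> ^ p"
  by (simp add: Dsup_def Dop_pow_expi norm_mult norm_power)

lemma continuous_on_expi [continuous_intros]: "continuous_on S (expi k)"
  using continuous_Dop[OF smooth_periodic_expi, of S 0] by simp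

text \<open>The pairing of the functional \<open>expi k\<close> with \<phi>, hence neither
  conjugated nor normalised: it is \<open>2 * pi\<close> times the usual coefficient of index
  \<open>- k\<close>.\<close>

definition fourier :: "int \<Rightarrow> (real \<Rightarrow> complex) \<Rightarrow> complex" where
  "fourier k \<phi> = integral {0..2 * pi} (\<lambda>t. expi k t * \<phi> t)"

lemma fourier_expi: "fourier k (expi l) = (if k + l = 0 then 2 * pi else 0)"
proof (cases "k + l = 0")
  case False
  \<comment> \<open>For a nonzero frequency the exponential is, up to a constant, the derivative of
    a periodic function.\<close>
  have "((\<lambda>t. \<i> * (of_int (k + l) * expi (k + l) t)) has_integral expi (k + l) (2 * pi) - expi (k + l) 0) {0..2 * pi}"
    by (rule fundamental_theorem_of_calculus)
      (simp_all del: of_int_add add: has_vector_derivative_at_within[OF expi_has_vector_derivative])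
  then have "((\<lambda>t. \<i> * of_int (k + l) * expi (k + l) t) has_integral 0) {0..2 * pi}"
    using expi_periodic[of "k + l" 0] by (simp add: mult.assoc)
  then have "((\<lambda>t. inverse (\<i> * of_int (k + l)) * (\<i> * of_int (k + l) * expi (k + l) t)) has_integral
      inverse (\<i> * of_int (k + l)) * 0) {0..2 * pi}"
    by (rule has_integral_mult_right)
  moreover have "inverse (\<i> * of_int (k + l)) * (\<i> * of_int (k + l) * z) = z" for z
  proof -
    have "\<i> * of_int (k + l) \<noteq> 0" using False by (simp del: of_int_add)
    then show ?thesis by (metis left_inverse mult.assoc mult_1)
  qed
  ultimately have "(expi (k + l) has_integral 0) {0..2 * pi}"
    by (simp del: of_int_add)
  then have "integral {0..2 * pi} (expi (k + l)) = 0" by (rule integral_unique)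
  then show ?thesis using False by (simp add: fourier_def expi_add)
qed (simp add: fourier_def expi_add expi_0 scaleR_conv_of_real)

text \<open>Integration by parts, with boundary terms cancelling by periodicity. The minus sign
  reflects the pairing without conjugation.\<close>

lemma fourier_Dop_pow:
  assumes "\<phi> \<in> smooth_periodic"
  shows "fourier k ((Dop ^^ p) \<phi>) = (- of_int k) ^ p * fourier k \<phi>"
proof (induction p)
  case (Suc p)
  let ?f = "(Dop ^^ p) \<phi>" and ?f' = "(Dop ^^ Suc p) \<phi>"
  have int: "(\<lambda>t. expi k t * (Dop ^^ q) \<phi> t) integrable_on {0..2 * pi}" for q
    by (intro integrable_continuous_interval continuous_intros continuous_Dop assms)
  have "((\<lambda>t. \<i> * (of_int k * (expi k t * ?f t) + expi k t * ?f' t)) has_integral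
      expi k (2 * pi) * ?f (2 * pi) - expi k 0 * ?f 0) {0..2 * pi}"
  proof (rule fundamental_theorem_of_calculus)
    fix t
    have "((\<lambda>t. expi k t * ?f t) has_vector_derivative
        expi k t * (\<i> * ?f' t) + \<i> * (of_int k * expi k t) * ?f t) (at t within {0..2 * pi})"
      by (intro has_vector_derivative_mult has_vector_derivative_at_within[OF expi_has_vector_derivative]
        has_vector_derivative_at_within[OF Dop_has_vector_derivative[OF assms]])
    then show "((\<lambda>t. expi k t * ?f t) has_vector_derivative
        \<i> * (of_int k * (expi k t * ?f t) + expi k t * ?f' t)) (at t within {0..2 * pi})"
      by (simp add: algebra_simps)
  qed simp
  then have "((\<lambda>t. \<i> * (of_int k * (expi k t * ?f t) + expi k t * ?f' t)) has_integral 0) {0..2 * pi}"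
    using expi_periodic[of k 0] periodic_Dop[OF assms, of p 0] by simp
  from integral_unique[OF this]
  have "\<i> * (of_int k * fourier k ?f + fourier k ?f') = 0"
    unfolding fourier_def
    by (simp add: integral_add[OF integrable_on_mult_right[OF int[of p]] int[of "Suc p"]]
        del: funpow.simps)
  then have "fourier k ?f' = - of_int k * fourier k ?f"
    by (metis add.commute add_eq_0_iff complex_i_not_zero minus_mult_left mult_eq_0_iff)
  then show ?case using Suc by (simp add: mult.assoc)
qed simp

lemma norm_fourier_le:
  assumes "continuous_on {0..2 * pi} \<phi>" "\<And>t. t \<in> {0..2 * pi} \<Longrightarrow> cmod (\<phi> t) \<le> B"
  shows "cmod (fourier k \<phi>) \<le> 2 * pi * B"
proof -
  have "cmod (fourier k \<phi>) \<le> B * (2 * pi - 0)"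
    unfolding fourier_def
    by (rule integral_bound) (use assms in \<open>auto intro!: continuous_intros simp: norm_mult\<close>)
  then show ?thesis by (simp add: mult.commute)
qed

lemma norm_fourier_le_Dsup:
  assumes "\<phi> \<in> smooth_periodic"
  shows "\<bar>of_int k\<bar> ^ p * cmod (fourier k \<phi>) \<le> 2 * pi * Dsup p \<phi>"
proof -
  have "cmod (fourier k ((Dop ^^ p) \<phi>)) \<le> 2 * pi * Dsup p \<phi>"
    by (intro norm_fourier_le continuous_Dop Dop_le_Dsup assms)
  then show ?thesis
    by (simp add: fourier_Dop_pow[OF assms] norm_mult norm_power)
qed

lemma fourier_add:
  assumes "continuous_on {0..2 * pi} \<phi>" "continuous_on {0..2 * pi} \<psi>"
  shows "fourier k (\<lambda>t. \<phi> t + \<psi> t) = fourier k \<phi> + fourier k \<psi>"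
  unfolding fourier_def distrib_left
  by (intro integral_add integrable_continuous_interval continuous_intros assms)

lemma fourier_cmult: "fourier k (\<lambda>t. c * \<phi> t) = c * fourier k \<phi>"
  by (simp add: fourier_def mult.left_commute[of _ c])

text \<open>Frequencies are a free sequence so that \<open>f\<close> and its product with an
  exponential are both instances, with the same coefficients and with frequencies moved by a
  constant.\<close>

definition trig_series :: "(nat \<Rightarrow> int) \<Rightarrow> (nat \<Rightarrow> complex) \<Rightarrow> real \<Rightarrow> complex" where
  "trig_series \<kappa> c t = (\<Sum>n. c n * expi (\<kappa> n) t)"

lemma
  assumes "\<And>p. summable (\<lambda>n. cmod (c n) * \<bar>of_int (\<kappa> n)\<bar> ^ p)"
  shows smooth_periodic_trig_series: "trig_series \<kappa> c \<in> smooth_periodic"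
    and Dsup_trig_series: "Dsup p (trig_series \<kappa> c) \<le> (\<Sum>n. cmod (c n) * \<bar>of_int (\<kappa> n)\<bar> ^ p)"
proof -
  let ?g = "\<lambda>n t. c n * expi (\<kappa> n) t"
  have smooth: "?g n \<in> smooth_periodic" for n
    by (intro smooth_periodic_cmult smooth_periodic_expi)
  have le: "Dsup p (?g n) \<le> cmod (c n) * \<bar>of_int (\<kappa> n)\<bar> ^ p" for n p
    using Dsup_cmult[OF smooth_periodic_expi] by (simp add: Dsup_expi)
  have sum: "summable (\<lambda>n. Dsup p (?g n))" for p
    by (rule summable_comparison_test'[OF assms[of p]]) (simp add: le Dsup_nonneg[OF smooth])
  have eq: "trig_series \<kappa> c = (\<lambda>t. \<Sum>n. ?g n t)"
    by (simp add: trig_series_def fun_eq_iff)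
  show "trig_series \<kappa> c \<in> smooth_periodic"
    unfolding eq by (rule smooth_periodic_suminf(1)[OF smooth sum])
  have "Dsup p (trig_series \<kappa> c) \<le> (\<Sum>n. Dsup p (?g n))"
    unfolding eq by (rule smooth_periodic_suminf(2)[OF smooth sum])
  also have "\<dots> \<le> (\<Sum>n. cmod (c n) * \<bar>of_int (\<kappa> n)\<bar> ^ p)"
    by (intro suminf_le le sum assms)
  finally show "Dsup p (trig_series \<kappa> c) \<le> (\<Sum>n. cmod (c n) * \<bar>of_int (\<kappa> n)\<bar> ^ p)" .
qed

lemma integral_trig_series:
  assumes "summable (\<lambda>n. cmod (c n))" "\<psi> \<in> smooth_periodic"
  shows "(\<lambda>n. c n * fourier (\<kappa> n) \<psi>) sums integral {0..2 * pi} (\<lambda>t. trig_series \<kappa> c t * \<psi> t)"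
proof -
  let ?g = "\<lambda>n t. c n * (expi (\<kappa> n) t * \<psi> t)"
  have cont: "continuous_on S \<psi>" for S using continuous_Dop[OF assms(2), of S 0] by simp
  have "(\<lambda>n. integral {0..2 * pi} (?g n)) sums integral {0..2 * pi} (\<lambda>t. \<Sum>n. ?g n t)"
  proof (rule integral_suminf)
    show "continuous_on {0..2 * pi} (?g n)" for n
      by (intro continuous_intros cont)
    show "cmod (?g n t) \<le> cmod (c n) * Dsup 0 \<psi>" for n t
      using Dop_le_Dsup[OF assms(2), of 0 t] by (simp add: norm_mult mult_left_mono)
    show "summable (\<lambda>n. cmod (c n) * Dsup 0 \<psi>)"
      using assms(1) by (rule summable_mult2)
  qed
  moreover have "(\<Sum>n. ?g n t) = trig_series \<kappa> c t * \<psi> t" for t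
  proof -
    have "summable (\<lambda>n. c n * expi (\<kappa> n) t)"
      by (rule summable_norm_cancel) (simp add: norm_mult assms(1))
    then show ?thesis
      unfolding trig_series_def by (subst suminf_mult2) (simp_all add: mult.assoc)
  qed
  ultimately show ?thesis by (simp add: fourier_def)
qed

section \<open>Geometric series and functions as ultradistributions\<close>

lemma summable_inverse_Suc_square: "summable (\<lambda>n. 1 / (real n + 1)\<^sup>2)"
  using summable_Suc_iff[of "\<lambda>n. 1 / real n ^ 2"] inverse_power_summable[of 2, where 'a = real]
  by (simp add: field_simps)

text \<open>The two geometric series \<open>1/(1 - e\<^bsup>it\<^esup>)\<close> and \<open>1/(1 - e\<^bsup>-it\<^esup>)\<close>, for
  \<open>\<sigma> = 1\<close> and \<open>\<sigma> = -1\<close>.\<close>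

definition geometric_functional :: "ultra_class \<Rightarrow> int \<Rightarrow> functional" where
  "geometric_functional K \<sigma> =
     (\<lambda>\<phi>. if \<phi> \<in> E_space K then \<Sum>n. fourier (\<sigma> * int n) \<phi> else 0)"

text \<open>Derivatives of order 0 and 2 together give the factor \<open>1 + n\<^sup>2\<close>,
  which unlike \<open>n\<^sup>2\<close> also controls \<open>n = 0\<close>. Comparing it with
  \<open>(n + 1)\<^sup>2\<close> costs a factor 2 and turns \<open>2 * pi\<close> into
  \<open>4 * pi\<close>.\<close>

lemma
  assumes "\<bar>\<sigma>\<bar> = 1" "\<phi> \<in> smooth_periodic"
  shows norm_fourier_le_inverse_square: 
      "cmod (fourier (\<sigma> * int n) \<phi>) \<le> 4 * pi * (Dsup 0 \<phi> + Dsup 2 \<phi>) * (1 / (real n + 1)\<^sup>2)" (is ?A)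
    and summable_fourier: "summable (\<lambda>n. cmod (fourier (\<sigma> * int n) \<phi>))" (is ?B)
proof -
  have A: "cmod (fourier (\<sigma> * int n) \<phi>) \<le> 4 * pi * (Dsup 0 \<phi> + Dsup 2 \<phi>) * (1 / (real n + 1)\<^sup>2)" for n
  proof -
    let ?F = "cmod (fourier (\<sigma> * int n) \<phi>)"
    have "\<bar>of_int (\<sigma> * int n)\<bar> = real n"
      using assms(1) by (simp add: abs_mult flip: of_int_abs)
    then have "(1 + (real n)\<^sup>2) * ?F \<le> 2 * pi * (Dsup 0 \<phi> + Dsup 2 \<phi>)"
      using norm_fourier_le_Dsup[OF assms(2), of "\<sigma> * int n" 0]
        norm_fourier_le_Dsup[OF assms(2), of "\<sigma> * int n" 2] by (simp add: algebra_simps)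
    \<comment> \<open>The inequality between the factors is a rearrangement of
      \<open>0 \<le> (n - 1)\<^sup>2\<close>.\<close>
    moreover have "(real n + 1)\<^sup>2 * ?F \<le> (2 * (1 + (real n)\<^sup>2)) * ?F"
      using zero_le_power2[of "real n - 1"] by (intro mult_right_mono) (auto simp: power2_eq_square algebra_simps)
    ultimately have "(real n + 1)\<^sup>2 * ?F \<le> 4 * pi * (Dsup 0 \<phi> + Dsup 2 \<phi>)"
      by linarith
    then show ?thesis by (simp add: field_simps)
  qed
  then show ?A .
  show ?B
    by (rule summable_comparison_test'[OF summable_mult[OF summable_inverse_Suc_square]])
      (use A in simp)
qed

lemma geometric_functional_in_E_dual:
  assumes pos: "\<And>p. weight K p > 0" and \<sigma>: "\<bar>\<sigma>\<bar> = 1"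
  shows "geometric_functional K \<sigma> \<in> E_dual K"
proof -
  have summable: "summable (\<lambda>n. fourier (\<sigma> * int n) \<phi>)" if "\<phi> \<in> E_space K" for \<phi>
    using summable_fourier[OF \<sigma> E_space_smooth_periodic[OF that]] by (rule summable_norm_cancel)
  have cont: "continuous_on {0..2 * pi} \<phi>" if "\<phi> \<in> E_space K" for \<phi>
    using continuous_Dop[OF E_space_smooth_periodic[OF that], of _ 0] by simp
  define S where "S = (\<Sum>n. 1 / (real n + 1)\<^sup>2)"
  show ?thesis
  proof (rule E_dualI[OF pos])
    fix \<phi> \<psi> assume "\<phi> \<in> E_space K" "\<psi> \<in> E_space K"
    then show "geometric_functional K \<sigma> (\<lambda>t. \<phi> t + \<psi> t) =
        geometric_functional K \<sigma> \<phi> + geometric_functional K \<sigma> \<psi>"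
      using summable
      by (simp add: geometric_functional_def E_space_add[OF pos] fourier_add cont suminf_add)
  next
    fix c \<phi> assume "\<phi> \<in> E_space K"
    then show "geometric_functional K \<sigma> (\<lambda>t. c * \<phi> t) = c * geometric_functional K \<sigma> \<phi>"
      using summable
      by (simp add: geometric_functional_def E_space_cmult[OF pos] fourier_cmult suminf_mult)
  next
    fix \<phi> assume \<phi>: "\<phi> \<in> E_space K"
    note smooth = E_space_smooth_periodic[OF \<phi>]
    have "cmod (\<Sum>n. fourier (\<sigma> * int n) \<phi>) \<le> (\<Sum>n. cmod (fourier (\<sigma> * int n) \<phi>))"
      by (intro summable_norm summable_fourier \<sigma> smooth)
    also have "\<dots> \<le> (\<Sum>n. 4 * pi * (Dsup 0 \<phi> + Dsup 2 \<phi>) * (1 / (real n + 1)\<^sup>2))"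
      by (intro suminf_le norm_fourier_le_inverse_square summable_fourier \<sigma> smooth
          summable_mult summable_inverse_Suc_square)
    also have "\<dots> = 4 * pi * S * (Dsup 0 \<phi> + Dsup 2 \<phi>)"
      unfolding S_def by (subst suminf_mult[OF summable_inverse_Suc_square]) (simp add: mult_ac)
    finally show "cmod (geometric_functional K \<sigma> \<phi>) \<le> 4 * pi * S * (Dsup 0 \<phi> + Dsup 2 \<phi>)"
      using \<phi> by (simp add: geometric_functional_def)
  next
    have "S \<ge> 0" unfolding S_def by (intro suminf_nonneg summable_inverse_Suc_square) simp
    then show "4 * pi * S \<ge> 0" by simp
  qed (simp add: geometric_functional_def)
qed

lemma fun_functional_in_E_dual:
  assumes pos: "\<And>p. weight K p > 0" and f: "continuous_on {0..2 * pi} f"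
  shows "fun_functional K f \<in> E_dual K"
proof -
  have cont: "continuous_on {0..2 * pi} \<phi>" if "\<phi> \<in> E_space K" for \<phi>
    using continuous_Dop[OF E_space_smooth_periodic[OF that], of _ 0] by simp
  have "compact (f ` {0..2 * pi})"
    using f by (intro compact_continuous_image) auto
  then obtain B where "B > 0" and B: "\<And>t. t \<in> {0..2 * pi} \<Longrightarrow> cmod (f t) \<le> B"
    using compact_imp_bounded bounded_pos by (metis image_eqI)
  show ?thesis
  proof (rule E_dualI[OF pos])
    fix \<phi> \<psi> assume E: "\<phi> \<in> E_space K" "\<psi> \<in> E_space K"
    have "integral {0..2 * pi} (\<lambda>t. f t * \<phi> t + f t * \<psi> t) =
        integral {0..2 * pi} (\<lambda>t. f t * \<phi> t) + integral {0..2 * pi} (\<lambda>t. f t * \<psi> t)"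
      by (intro integral_add integrable_continuous_interval continuous_intros f cont E)
    with E show "fun_functional K f (\<lambda>t. \<phi> t + \<psi> t) = fun_functional K f \<phi> + fun_functional K f \<psi>"
      by (simp add: fun_functional_def E_space_add[OF pos] distrib_left)
  next
    fix c \<phi> assume "\<phi> \<in> E_space K"
    then show "fun_functional K f (\<lambda>t. c * \<phi> t) = c * fun_functional K f \<phi>"
      by (simp add: fun_functional_def E_space_cmult[OF pos] mult.left_commute[of _ c])
  next
    fix \<phi> assume \<phi>: "\<phi> \<in> E_space K"
    note smooth = E_space_smooth_periodic[OF \<phi>]
    have "cmod (f t * \<phi> t) \<le> B * Dsup 0 \<phi>" if "t \<in> {0..2 * pi}" for t
      using Dop_le_Dsup[OF smooth, of 0 t] B[OF that] \<open>B > 0\<close>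
      by (simp add: norm_mult mult_mono)
    then have "cmod (integral {0..2 * pi} (\<lambda>t. f t * \<phi> t)) \<le> B * Dsup 0 \<phi> * (2 * pi - 0)"
      by (intro integral_bound continuous_intros f cont \<phi>) auto
    also have "\<dots> \<le> 2 * pi * B * (Dsup 0 \<phi> + Dsup 2 \<phi>)"
      using \<open>B > 0\<close> Dsup_nonneg[OF smooth, of 2] by (simp add: algebra_simps)
    finally show "cmod (fun_functional K f \<phi>) \<le> 2 * pi * B * (Dsup 0 \<phi> + Dsup 2 \<phi>)"
      using \<phi> by (simp add: fun_functional_def)
  qed (use \<open>B > 0\<close> in \<open>simp_all add: fun_functional_def\<close>)
qed

section \<open>Symbols of ultradifferential operators\<close>

text \<open>The growth half of \<open>ultra_symbol\<close>, detached from any function so that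
  coefficients can be estimated before their power series is known to be entire.\<close>

primrec coeff_bound :: "ultra_class \<Rightarrow> (nat \<Rightarrow> complex) \<Rightarrow> bool" where
  "coeff_bound (Beurling M) a \<longleftrightarrow> (\<exists>L>0. \<exists>C>0. \<forall>n. cmod (a n) \<le> C * L ^ n / M n)"
| "coeff_bound (Roumieu M) a \<longleftrightarrow> (\<forall>L>0. \<exists>C>0. \<forall>n. cmod (a n) \<le> C * L ^ n / M n)"

text \<open>The growth half of membership in \<open>E_space\<close>, for arbitrary bounds
  \<open>b\<close> on the derivatives. Its quantifiers are opposite to those of
  \<open>coeff_bound\<close>, as suits two conditions that are paired with each other.\<close>

primrec decay :: "ultra_class \<Rightarrow> (nat \<Rightarrow> real) \<Rightarrow> bool" where
  "decay (Beurling M) b \<longleftrightarrow> (\<forall>h>0. \<exists>C. \<forall>p. h ^ p * b p \<le> C * M p)"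
| "decay (Roumieu M) b \<longleftrightarrow> (\<exists>h>0. \<exists>C. \<forall>p. h ^ p * b p \<le> C * M p)"

lemma ultra_symbol_iff:
  "ultra_symbol K P \<longleftrightarrow> P holomorphic_on UNIV \<and> coeff_bound K (taylor_coeff P)"
  by (cases K) simp_all

lemma E_space_iff:
  assumes "\<And>p. weight K p > 0"
  shows "\<phi> \<in> E_space K \<longleftrightarrow> \<phi> \<in> smooth_periodic \<and> decay K (\<lambda>p. Dsup p \<phi>)"
  using assms by (cases K) (auto simp: E_step_iff intro: zero_less_one)

lemma decay_cmult_mono:
  assumes "decay K b" "\<And>p. c p \<le> S * b p" "S \<ge> 0"
  shows "decay K c"
proof -
  have *: "\<exists>C. \<forall>p. h ^ p * c p \<le> C * M p" if "h > 0" "\<forall>p. h ^ p * b p \<le> C * M p" for h C and M :: "nat \<Rightarrow> real"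
  proof (intro exI allI)
    fix p
    have "h ^ p * c p \<le> h ^ p * (S * b p)" using assms that by (intro mult_left_mono) auto
    also have "\<dots> = S * (h ^ p * b p)" by simp
    also have "\<dots> \<le> S * (C * M p)" using that assms by (intro mult_left_mono) auto
    finally show "h ^ p * c p \<le> (S * C) * M p" by (simp add: mult.assoc)
  qed
  show ?thesis
  proof (cases K)
    case (Beurling M)
    then show ?thesis using assms(1) * by simp blast
  next
    case (Roumieu M)
    then show ?thesis using assms(1) * by simp blast
  qed
qed

text \<open>Only the frequencies -1, 0 and 1 enter the contradiction. Their derivatives are bounded
  by 1, so the constant sequence decides membership.\<close>

lemma expi_in_E_space:
  assumes "\<And>p. weight K p > 0" "decay K (\<lambda>_. 1)" "\<bar>k\<bar> \<le> 1"
  shows "expi k \<in> E_space K"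
proof -
  have "\<bar>of_int k\<bar> \<le> (1::real)" using assms(3) by linarith
  then have "decay K (\<lambda>p. Dsup p (expi k))"
    using decay_cmult_mono[OF assms(2), of _ 1] by (simp add: Dsup_expi power_le_one)
  then show ?thesis
    unfolding E_space_iff[OF assms(1)] by (simp add: smooth_periodic_expi)
qed

lemma taylor_coeff_eq: "taylor_coeff P n = (deriv ^^ n) P 0 / fact n"
  by (simp add: taylor_coeff_def fps_expansion_def)

text \<open>Reflection and translation of symbols are both affine substitutions; coefficients at 0
  become derivatives at \<open>c\<close>.\<close>

lemma taylor_coeff_affine:
  assumes "P holomorphic_on UNIV"
  shows "taylor_coeff (\<lambda>z. P (u * z + c)) n = u ^ n * (deriv ^^ n) P c / fact n"
  using higher_deriv_compose_linear'[OF assms open_UNIV open_UNIV UNIV_I, of u c n 0]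
  by (simp add: taylor_coeff_eq)

lemma taylor_coeff_minus:
  assumes "P holomorphic_on UNIV"
  shows "taylor_coeff (\<lambda>z. P (- z)) n = (-1) ^ n * taylor_coeff P n"
  using taylor_coeff_affine[OF assms, of "-1" 0 n] by (simp add: taylor_coeff_eq)

lemma taylor_coeff_sums:
  assumes "P holomorphic_on UNIV"
  shows "(\<lambda>n. taylor_coeff P n * z ^ n) sums P z"
  using holomorphic_power_series[of P 0 "cmod z + 1" z] assms
  by (simp add: taylor_coeff_eq holomorphic_on_subset)

lemma coeff_bound_mono:
  assumes "coeff_bound K a" "\<And>n. cmod (b n) \<le> cmod (a n)"
  shows "coeff_bound K b"
  using assms by (cases K; simp; meson order_trans)

section \<open>Action of operators on test functions\<close>

context
  fixes M :: "nat \<Rightarrow> real" and A H :: real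
  assumes pos: "\<And>p. M p > 0" and AH: "A \<ge> 1" "H \<ge> 1"
    and M2: "\<And>p q. M (p + q) \<le> A * H ^ (p + q) * M p * M q"
begin

text \<open>(M.2) splits \<open>M (p + n)\<close> into \<open>M p * M n\<close> at the price of
  \<open>H ^ (p + n)\<close>. The factor \<open>M n\<close> cancels against the coefficient bound,
  leaving a geometric series in \<open>n\<close> of ratio \<open>L * H / h\<close>, while
  \<open>H ^ p\<close> accounts for the loss from \<open>h\<close> to \<open>h / H\<close>.\<close>

lemma E_step_operator:
  assumes a: "\<And>n. cmod (a n) \<le> C * L ^ n / M n" and "L > 0" "C > 0" "h > 0" "L * H < h"
    and \<phi>: "\<phi> \<in> E_step M h"
  shows "summable (\<lambda>n. cmod (a n) * Dsup (p + n) \<phi>)"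
    and "(\<lambda>t. \<Sum>n. a n * (Dop ^^ n) \<phi> t) \<in> E_step M (h / H)"
proof -
  from \<phi> obtain B where smooth: "\<phi> \<in> smooth_periodic" and B: "\<And>p. h ^ p * Dsup p \<phi> \<le> B * M p"
    unfolding E_step_iff[OF pos] by blast
  have "0 \<le> B * M 0" using B[of 0] Dsup_nonneg[OF smooth, of 0] by simp
  then have "B \<ge> 0" using pos[of 0] by (simp add: zero_le_mult_iff)
  define r where "r = L * H / h"
  have r: "0 < r" "r < 1" using assms AH by (auto simp: r_def)
  define S where "S p = C * B * A * (H / h) ^ p * M p" for p
  have le_geo: "cmod (a n) * Dsup (p + n) \<phi> \<le> S p * r ^ n" for n p
  proof -
    have "h ^ (p + n) * Dsup (p + n) \<phi> \<le> B * (A * H ^ (p + n) * M p * M n)"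
      using B[of "p + n"] mult_left_mono[OF M2[of p n] \<open>B \<ge> 0\<close>] by linarith
    then have "Dsup (p + n) \<phi> \<le> B * (A * H ^ (p + n) * M p * M n) / h ^ (p + n)"
      using \<open>h > 0\<close> by (simp add: pos_le_divide_eq mult.commute)
    then have "cmod (a n) * Dsup (p + n) \<phi> \<le>
        (C * L ^ n / M n) * (B * (A * H ^ (p + n) * M p * M n) / h ^ (p + n))"
      using a[of n] Dsup_nonneg[OF smooth] pos[of n] assms by (intro mult_mono) auto
    also have "\<dots> = S p * r ^ n"
      using pos[of n] \<open>h > 0\<close> by (simp add: S_def r_def power_add field_simps)
    finally show ?thesis .
  qed
  have geo: "summable (\<lambda>n. S p * r ^ n)" for p
    using r by (intro summable_mult summable_geometric) simp
  show sum: "summable (\<lambda>n. cmod (a n) * Dsup (p + n) \<phi>)" for p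
    by (rule summable_comparison_test'[OF geo[of p]])
      (use le_geo[of _ p] Dsup_nonneg[OF smooth] in simp)
  let ?g = "\<lambda>n t. a n * (Dop ^^ n) \<phi> t"
  have gsmooth: "?g n \<in> smooth_periodic" for n
    by (intro smooth_periodic_cmult smooth_periodic_Dop_pow smooth)
  have gle: "Dsup p (?g n) \<le> cmod (a n) * Dsup (p + n) \<phi>" for n p
    using Dsup_cmult[OF smooth_periodic_Dop_pow[OF smooth]] by (simp add: Dsup_Dop_pow)
  have gsum: "summable (\<lambda>n. Dsup p (?g n))" for p
    by (rule summable_comparison_test'[OF sum[of p]]) (simp add: gle Dsup_nonneg[OF gsmooth])
  have "(h / H) ^ p * Dsup p (\<lambda>t. \<Sum>n. ?g n t) \<le> (C * B * A * (1 / (1 - r))) * M p" for p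
  proof -
    have "Dsup p (\<lambda>t. \<Sum>n. ?g n t) \<le> (\<Sum>n. Dsup p (?g n))"
      by (rule smooth_periodic_suminf(2)[OF gsmooth gsum])
    also have "\<dots> \<le> (\<Sum>n. S p * r ^ n)"
      by (intro suminf_le gsum geo order_trans[OF gle le_geo])
    also have "\<dots> = S p * (1 / (1 - r))"
      using r by (simp add: suminf_mult suminf_geometric summable_geometric)
    finally have "(h / H) ^ p * Dsup p (\<lambda>t. \<Sum>n. ?g n t) \<le> (h / H) ^ p * (S p * (1 / (1 - r)))"
      using \<open>h > 0\<close> AH by (intro mult_left_mono) auto
    also have "\<dots> = (C * B * A * (1 / (1 - r))) * M p"
      using \<open>h > 0\<close> AH r by (simp add: S_def power_divide field_simps)
    finally show ?thesis .
  qed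
  then show "(\<lambda>t. \<Sum>n. ?g n t) \<in> E_step M (h / H)"
    unfolding E_step_iff[OF pos] using smooth_periodic_suminf(1)[OF gsmooth gsum] by blast
qed

end

lemma
  assumes pos: "\<And>p. weight K p > 0" and M2: "cond_M2 (weight K)"
    and a: "coeff_bound K a" and \<phi>: "\<phi> \<in> E_space K"
  shows summable_operator: "summable (\<lambda>n. cmod (a n) * Dsup n \<phi>)"
    and E_space_operator: "(\<lambda>t. \<Sum>n. a n * (Dop ^^ n) \<phi> t) \<in> E_space K"
proof -
  from M2 obtain A H where AH: "A \<ge> 1" "H \<ge> 1"
    and M2': "\<And>p q. weight K (p + q) \<le> A * H ^ (p + q) * weight K p * weight K q"
    unfolding cond_M2_def by blast
  note step = E_step_operator[OF pos AH M2', of a]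
  have "summable (\<lambda>n. cmod (a n) * Dsup n \<phi>) \<and> (\<lambda>t. \<Sum>n. a n * (Dop ^^ n) \<phi> t) \<in> E_space K"
  proof (cases K)
    case (Beurling M)
    with a obtain L C where LC: "L > 0" "C > 0" "\<And>n. cmod (a n) \<le> C * L ^ n / weight K n"
      by auto
    have \<phi>': "\<phi> \<in> E_step (weight K) h" if "h > 0" for h using \<phi> that Beurling by auto
    have "(\<lambda>t. \<Sum>n. a n * (Dop ^^ n) \<phi> t) \<in> E_step (weight K) k" if "k > 0" for k
    proof -
      \<comment> \<open>Large enough for the geometric series to converge and for
        \<open>h / H\<close> to stay above the prescribed \<open>k\<close>; a Beurling function lies
        in every step.\<close>
      define h where "h = (k + L + L) * H"
      have h: "h > 0" "L * H < h" "k \<le> h / H"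
        using that LC AH by (auto simp: h_def)
      then show ?thesis
        using step(2)[OF LC(3,1,2) h(1,2) \<phi>'[OF h(1)]] E_step_mono[of "weight K", OF pos that h(3)] by blast
    qed
    moreover have "summable (\<lambda>n. cmod (a n) * Dsup n \<phi>)"
      using step(1)[OF LC(3,1,2), of "L * H + 1" \<phi> 0] \<phi>'[of "L * H + 1"] LC AH
      by (simp add: add_pos_pos)
    ultimately show ?thesis using Beurling by simp
  next
    case (Roumieu M)
    with \<phi> obtain h where h: "h > 0" "\<phi> \<in> E_step (weight K) h" by auto
    \<comment> \<open>The step of \<phi> is given first, and the Roumieu coefficients allow
      \<open>L\<close> to be chosen afterwards; the ratio becomes 1/2.\<close>
    define L where "L = h / (2 * H)"
    have L: "L > 0" "L * H < h" using h AH by (auto simp: L_def)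
    with a Roumieu obtain C where "C > 0" "\<And>n. cmod (a n) \<le> C * L ^ n / weight K n" by auto
    note this' = this(2) L(1) this(1) h(1) L(2) h(2)
    have "h / H > 0" using h AH by simp
    then show ?thesis
      using step(1)[OF this', of 0] step(2)[OF this'] Roumieu by auto
  qed
  then show "summable (\<lambda>n. cmod (a n) * Dsup n \<phi>)"
    and "(\<lambda>t. \<Sum>n. a n * (Dop ^^ n) \<phi> t) \<in> E_space K" by auto
qed

text \<open>The reflected symbol of the transposed operator cancels the sign from
  \<open>fourier_Dop_pow\<close>, so that the operator multiplies frequency \<open>k\<close> by
  \<open>P k\<close>.\<close>

lemma
  assumes pos: "\<And>p. weight K p > 0" and M2: "cond_M2 (weight K)"
    and P: "ultra_symbol K P" and \<phi>: "\<phi> \<in> E_space K"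
  shows op_fun_in_E_space: "op_fun (\<lambda>z. P (- z)) \<phi> \<in> E_space K"
    and fourier_op_fun: "fourier k (op_fun (\<lambda>z. P (- z)) \<phi>) = P (of_int k) * fourier k \<phi>"
proof -
  let ?b = "taylor_coeff (\<lambda>z. P (- z))"
  note smooth = E_space_smooth_periodic[OF \<phi>]
  have holo: "P holomorphic_on UNIV" using P by (simp add: ultra_symbol_iff)
  have b: "?b n = (-1) ^ n * taylor_coeff P n" for n
    by (rule taylor_coeff_minus[OF holo])
  have bound: "coeff_bound K ?b"
    by (rule coeff_bound_mono[of _ "taylor_coeff P"])
      (use P in \<open>simp_all add: ultra_symbol_iff b norm_mult norm_power\<close>)
  show "op_fun (\<lambda>z. P (- z)) \<phi> \<in> E_space K"
    using E_space_operator[OF pos M2 bound \<phi>] by (simp add: op_fun_def[abs_def])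
  have summ: "summable (\<lambda>n. cmod (?b n) * Dsup n \<phi>)"
    by (rule summable_operator[OF pos M2 bound \<phi>])
  let ?g = "\<lambda>n t. ?b n * (expi k t * (Dop ^^ n) \<phi> t)"
  have le: "cmod (?b n * (Dop ^^ n) \<phi> t) \<le> cmod (?b n) * Dsup n \<phi>" for n t
    using Dop_le_Dsup[OF smooth] by (simp add: norm_mult mult_left_mono)
  have "(\<lambda>n. integral {0..2 * pi} (?g n)) sums integral {0..2 * pi} (\<lambda>t. \<Sum>n. ?g n t)"
    by (rule integral_suminf[OF _ _ summ])
      (use le in \<open>auto intro!: continuous_intros continuous_Dop[OF smooth] simp: norm_mult\<close>)
  moreover have "(\<Sum>n. ?g n t) = expi k t * op_fun (\<lambda>z. P (- z)) \<phi> t" for t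
  proof -
    have "summable (\<lambda>n. ?b n * (Dop ^^ n) \<phi> t)"
      by (rule summable_comparison_test'[OF summ]) (rule le)
    from suminf_mult[OF this, of "expi k t"] show ?thesis
      by (simp add: op_fun_def mult_ac)
  qed
  moreover have "integral {0..2 * pi} (?g n) = taylor_coeff P n * of_int k ^ n * fourier k \<phi>" for n
  proof -
    have "integral {0..2 * pi} (?g n) = ?b n * fourier k ((Dop ^^ n) \<phi>)"
      by (simp add: fourier_def)
    then show ?thesis
      by (simp add: fourier_Dop_pow[OF smooth] b power_minus[of "of_int k"] mult_ac)
  qed
  ultimately have "(\<lambda>n. taylor_coeff P n * of_int k ^ n * fourier k \<phi>) sums fourier k (op_fun (\<lambda>z. P (- z)) \<phi>)"
    by (simp add: fourier_def)
  moreover have "(\<lambda>n. taylor_coeff P n * of_int k ^ n * fourier k \<phi>) sums (P (of_int k) * fourier k \<phi>)"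
    by (intro sums_mult2 taylor_coeff_sums holo)
  ultimately show "fourier k (op_fun (\<lambda>z. P (- z)) \<phi>) = P (of_int k) * fourier k \<phi>"
    by (rule sums_unique2)
qed

section \<open>Entire symbols with prescribed coefficients and their translates\<close>

lemma summable_power_divide:
  assumes "\<And>p. 1 \<le> C * h ^ p * M p" "\<And>p. M p > 0" "h > 0" "r > 0" "r * h < 1"
  shows "summable (\<lambda>n. r ^ n / M n :: real)"
proof (rule summable_comparison_test')
  show "summable (\<lambda>n. C * (r * h) ^ n)"
    using assms by (intro summable_mult summable_geometric) simp
  fix n
  have "r ^ n * 1 \<le> r ^ n * (C * h ^ n * M n)"
    using assms by (intro mult_left_mono) auto
  then show "norm (r ^ n / M n) \<le> C * (r * h) ^ n"
    using assms(2)[of n] assms(4) by (simp add: field_simps power_mult_distrib)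
qed

text \<open>By log-convexity the quotients \<open>M (q + 1) / M q\<close> increase. Since
  \<open>M 0 = 1\<close>, both \<open>M q\<close> and \<open>M (p + q) / M p\<close> are products of
  \<open>q\<close> consecutive quotients, the latter starting further along.\<close>

lemma cond_M1_mult_le:
  assumes "cond_M1 M" "M 0 = 1" "\<And>p. M p > 0"
  shows "M p * M q \<le> M (p + q)"
proof -
  have step: "M (Suc q) / M q \<le> M (Suc (Suc q)) / M (Suc q)" for q
  proof -
    have "M (Suc q) * M (Suc q) \<le> M q * M (Suc (Suc q))"
      using assms(1) unfolding cond_M1_def by (metis One_nat_def Suc_eq_plus1 Suc_le_mono
        diff_Suc_1 le0 power2_eq_square)
    then show ?thesis using assms(3)[of q] assms(3)[of "Suc q"] by (simp add: field_simps)
  qed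
  have mono: "M (Suc q) / M q \<le> M (Suc (p + q)) / M (p + q)" for p q
    by (induction p) (use step order_trans in auto)
  show ?thesis
  proof (induction q)
    case (Suc q)
    have "M p * M (Suc q) = (M p * M q) * (M (Suc q) / M q)"
      using assms(3)[of q] by simp
    also have "\<dots> \<le> M (p + q) * (M (Suc (p + q)) / M (p + q))"
      using Suc mono[of q p] assms(3) by (intro mult_mono divide_nonneg_nonneg) (auto intro: less_imp_le)
    also have "\<dots> = M (p + Suc q)" using assms(3)[of "p + q"] by simp
    finally show ?case .
  qed (simp add: assms)
qed

text \<open>Expresses the Taylor coefficients at an arbitrary point through those at 0; the point
  needed is 1, the amount of translation.\<close>

lemma higher_deriv_eval_fps:
  fixes F :: "complex fps"
  assumes "fps_conv_radius F = \<infinity>"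
  shows "(\<lambda>n. (fact (n + j) / fact n * fps_nth F (n + j)) * z ^ n) sums (deriv ^^ j) (eval_fps F) z"
proof -
  have radius: "fps_conv_radius ((fps_deriv ^^ j) F) = \<infinity>" for j
  proof (induction j)
    case (Suc j)
    then show ?case using fps_conv_radius_deriv[of "(fps_deriv ^^ j) F"] by simp
  qed (simp add: assms)
  have deriv: "(deriv ^^ j) (eval_fps F) = eval_fps ((fps_deriv ^^ j) F)"
  proof (induction j)
    case (Suc j)
    have "deriv (eval_fps ((fps_deriv ^^ j) F)) z = eval_fps ((fps_deriv ^^ Suc j) F) z" for z
      using DERIV_imp_deriv[OF has_field_derivative_eval_fps[of z "(fps_deriv ^^ j) F"]] radius
      by simp
    then show ?case using Suc by auto
  qed simp
  have nth: "fps_nth ((fps_deriv ^^ j) F) n = fact (n + j) / fact n * fps_nth F (n + j)" for n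
  proof (induction j arbitrary: n)
    case (Suc j)
    have "fps_nth ((fps_deriv ^^ Suc j) F) n =
        of_nat (Suc n) * (fact (Suc n + j) / fact (Suc n) * fps_nth F (Suc n + j))"
      by (simp add: Suc)
    also have "\<dots> = of_nat (Suc n) / fact (Suc n) * fact (Suc n + j) * fps_nth F (Suc n + j)"
      by simp
    also have "of_nat (Suc n) / fact (Suc n) = (1 / fact n :: complex)"
      by (simp del: of_nat_Suc)
    finally show ?case by (simp del: fact_Suc)
  qed simp
  show ?thesis
    using sums_eval_fps[of z "(fps_deriv ^^ j) F"] radius by (simp add: deriv nth)
qed

definition power_symbol :: "(nat \<Rightarrow> real) \<Rightarrow> complex \<Rightarrow> complex" where
  "power_symbol a = eval_fps (Abs_fps (\<lambda>n. of_real (a n)))"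

text \<open>The standing assumption of either class. Together with \<open>coeff_bound\<close> it
  makes power series entire.\<close>

definition dominates_one :: "ultra_class \<Rightarrow> bool" where
  "dominates_one K \<longleftrightarrow> (case K of Beurling M \<Rightarrow> seq_prec (\<lambda>p. 1) M | Roumieu M \<Rightarrow> seq_sub (\<lambda>p. 1) M)"

text \<open>In the Roumieu case the power series \<open>\<Sum>x\<^sup>n / M\<^sub>n\<close> may have finite radius of convergence;
  this is compensated by a small \<open>L\<close>.\<close>

lemma coeff_boundE:
  assumes pos: "\<And>p. weight K p > 0" and one: "dominates_one K" and a: "coeff_bound K a" and "r > 0"
  obtains L C where "L > 0" "C > 0" "\<And>n. cmod (a n) \<le> C * L ^ n / weight K n"
    "summable (\<lambda>n. (r * L) ^ n / weight K n)"
proof (cases K)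
  case (Beurling M)
  with a obtain L C where LC: "L > 0" "C > 0" "\<And>n. cmod (a n) \<le> C * L ^ n / weight K n"
    by auto
  \<comment> \<open>Here \<open>L\<close> is given and \<open>h\<close> is free; the product
    \<open>r * L * h\<close> becomes 1/2.\<close>
  define h where "h = 1 / (2 * (r * L))"
  have h: "h > 0" "r * L * h < 1" "r * L > 0" using LC \<open>r > 0\<close> by (auto simp: h_def)
  with one Beurling obtain D where "\<And>p. 1 \<le> D * h ^ p * weight K p"
    by (auto simp: dominates_one_def seq_prec_def)
  then have "summable (\<lambda>n. (r * L) ^ n / weight K n)"
    using h by (intro summable_power_divide[OF _ pos]) auto
  with LC show ?thesis by (rule that)
next
  case (Roumieu M)
  with one obtain D h where D: "h > 0" "\<And>p. 1 \<le> D * h ^ p * weight K p"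
    by (auto simp: dominates_one_def seq_sub_def)
  \<comment> \<open>The roles are exchanged: \<open>h\<close> is given and \<open>L\<close> is
    free.\<close>
  define L where "L = 1 / (2 * (r * h))"
  have L: "L > 0" "r * L * h < 1" using D \<open>r > 0\<close> by (auto simp: L_def)
  with a Roumieu obtain C where C: "C > 0" "\<And>n. cmod (a n) \<le> C * L ^ n / weight K n" by auto
  have "summable (\<lambda>n. (r * L) ^ n / weight K n)"
    using L D \<open>r > 0\<close> by (intro summable_power_divide[OF D(2) pos]) auto
  with L C show ?thesis using that by blast
qed

text \<open>The sum \<open>b\<close> is the j-th coefficient of the symbol translated by 1. The
  binomial is at most \<open>2 ^ (n + j)\<close>, which doubles \<open>L\<close>, and (M.1)
  separates \<open>M (n + j)\<close> into factors in \<open>n\<close> and \<open>j\<close>.\<close>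

lemma shifted_coeff_le:
  fixes M :: "nat \<Rightarrow> real" and a :: "nat \<Rightarrow> complex"
  assumes M: "cond_M1 M" "M 0 = 1" "\<And>p. M p > 0"
    and a: "\<And>n. cmod (a n) \<le> C * L ^ n / M n" and "L > 0" "C > 0"
    and sum: "summable (\<lambda>n. (2 * L) ^ n / M n)"
    and b: "(\<lambda>n. of_nat ((n + j) choose j) * a (n + j)) sums b"
  shows "cmod b \<le> C * (\<Sum>n. (2 * L) ^ n / M n) * (2 * L) ^ j / M j"
proof -
  have le: "cmod (of_nat ((n + j) choose j) * a (n + j)) \<le> C * (2 * L) ^ j / M j * ((2 * L) ^ n / M n)" for n
  proof -
    have "real ((n + j) choose j) \<le> 2 ^ (n + j)"
      using binomial_le_pow2[of "n + j" j] by (metis of_nat_le_iff of_nat_numeral of_nat_power)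
    moreover have "C * L ^ (n + j) / M (n + j) \<le> C * L ^ (n + j) / (M n * M j)"
      using cond_M1_mult_le[OF M, of n j] assms by (intro divide_left_mono) auto
    ultimately have "real ((n + j) choose j) * cmod (a (n + j)) \<le> 2 ^ (n + j) * (C * L ^ (n + j) / (M n * M j))"
      using a[of "n + j"] by (intro mult_mono) auto
    then show ?thesis by (simp add: norm_mult power_add power_mult_distrib mult_ac)
  qed
  have S: "summable (\<lambda>n. C * (2 * L) ^ j / M j * ((2 * L) ^ n / M n))"
    using sum by (rule summable_mult)
  have "cmod (\<Sum>n. of_nat ((n + j) choose j) * a (n + j)) \<le> (\<Sum>n. C * (2 * L) ^ j / M j * ((2 * L) ^ n / M n))"
    using le S by (rule norm_suminf_le)
  also have "\<dots> = C * (2 * L) ^ j / M j * (\<Sum>n. (2 * L) ^ n / M n)"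
    by (rule suminf_mult[OF sum])
  finally show ?thesis using b by (simp add: sums_iff mult_ac)
qed

lemma coeff_bound_shift:
  assumes pos: "\<And>p. weight K p > 0" and M1: "cond_M1 (weight K)" and M0: "weight K 0 = 1"
    and one: "dominates_one K" and a: "coeff_bound K a"
    and b: "\<And>j. (\<lambda>n. of_nat ((n + j) choose j) * a (n + j)) sums b j"
  shows "coeff_bound K b"
proof -
  have *: "\<exists>C'>0. \<forall>n. cmod (b n) \<le> C' * (2 * L) ^ n / weight K n"
    if "L > 0" "C > 0" "\<And>n. cmod (a n) \<le> C * L ^ n / weight K n"
      "summable (\<lambda>n. (2 * L) ^ n / weight K n)" for L C
  proof (intro exI conjI allI)
    show "cmod (b n) \<le> C * (\<Sum>n. (2 * L) ^ n / weight K n) * (2 * L) ^ n / weight K n" for n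
      using that b by (intro shifted_coeff_le[OF M1 M0 pos]) auto
    have "0 < (2 * L) ^ n / weight K n" for n using that pos[of n] by simp
    then show "C * (\<Sum>n. (2 * L) ^ n / weight K n) > 0"
      using that by (intro mult_pos_pos suminf_pos) auto
  qed
  obtain L C where LC: "L > 0" "C > 0" "\<And>n. cmod (a n) \<le> C * L ^ n / weight K n"
    "summable (\<lambda>n. (2 * L) ^ n / weight K n)"
    using coeff_boundE[OF pos one a, of 2] by auto
  show ?thesis
  proof (cases K)
    case (Beurling M)
    have "2 * L > 0" using LC by simp
    with *[OF LC] show ?thesis unfolding Beurling coeff_bound.simps weight.simps by blast
  next
    case (Roumieu M)
    have "\<exists>C'>0. \<forall>n. cmod (b n) \<le> C' * k ^ n / M n" if "k > 0" for k
    proof -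
      \<comment> \<open>Half of \<open>k\<close> compensates the doubling caused by translation;
        staying below \<open>L\<close> keeps the series summable by comparison.\<close>
      define l where "l = min L (k / 2)"
      have l: "l > 0" "l \<le> L" "2 * l \<le> k" using LC \<open>k > 0\<close> by (auto simp: l_def)
      obtain D where D: "D > 0" "\<And>n. cmod (a n) \<le> D * l ^ n / weight K n"
        using a l(1) Roumieu by auto
      have "summable (\<lambda>n. (2 * l) ^ n / weight K n)"
      proof (rule summable_comparison_test'[OF LC(4)])
        show "norm ((2 * l) ^ n / weight K n) \<le> (2 * L) ^ n / weight K n" for n
          using l pos[of n] by (simp add: divide_right_mono power_mono)
      qed
      from *[OF l(1) D this] obtain E
        where E: "E > 0" "\<And>n. cmod (b n) \<le> E * (2 * l) ^ n / weight K n" by blast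
      have "cmod (b n) \<le> E * k ^ n / M n" for n
      proof -
        have "E * (2 * l) ^ n / weight K n \<le> E * k ^ n / weight K n"
          using l E(1) pos[of n] by (intro divide_right_mono mult_left_mono power_mono) auto
        then show ?thesis using E(2)[of n] Roumieu by simp
      qed
      with E(1) show ?thesis by blast
    qed
    then show ?thesis using Roumieu by simp
  qed
qed

text \<open>Since \<sigma> is its own inverse, moving the argument by \<sigma> before the reflection
  is adding 1 after it. The factor \<open>\<sigma> ^ n\<close> has modulus 1, so the bounds reduce
  to the coefficients of one series at 0 and at 1.\<close>

lemma
  fixes a :: "nat \<Rightarrow> real"
  assumes pos: "\<And>p. weight K p > 0" and M1: "cond_M1 (weight K)" and M0: "weight K 0 = 1"
    and one: "dominates_one K" and a: "coeff_bound K (\<lambda>n. of_real (a n))" and \<sigma>: "\<bar>\<sigma>\<bar> = (1::int)"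
  shows power_symbol_sums: "(\<lambda>n. of_real (a n) * z ^ n) sums power_symbol a z"
    and ultra_symbol_power_symbol: "ultra_symbol K (\<lambda>z. power_symbol a (of_int \<sigma> * z))"
    and ultra_symbol_power_symbol_shift: "ultra_symbol K (\<lambda>z. power_symbol a (of_int \<sigma> * z + 1))"
proof -
  let ?F = "Abs_fps (\<lambda>n. complex_of_real (a n))"
  have "summable (\<lambda>n. of_real (a n) * z ^ n)" for z :: complex
  proof -
    \<comment> \<open>The radius is \<open>cmod z + 1\<close> because it has to be positive even for
      \<open>z = 0\<close>.\<close>
    obtain L C where LC: "L > 0" "C > 0" "\<And>n. cmod (of_real (a n)) \<le> C * L ^ n / weight K n"
      "summable (\<lambda>n. ((cmod z + 1) * L) ^ n / weight K n)"
      using coeff_boundE[OF pos one a, of "cmod z + 1"] by (auto simp: add_nonneg_pos)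
    show ?thesis
    proof (rule summable_comparison_test'[OF summable_mult[OF LC(4), of C]])
      fix n
      have "cmod (of_real (a n) * z ^ n) \<le> C * L ^ n / weight K n * (cmod z + 1) ^ n"
        unfolding norm_mult norm_power
        using LC pos[of n] by (intro mult_mono power_mono) auto
      then show "cmod (of_real (a n) * z ^ n) \<le> C * (((cmod z + 1) * L) ^ n / weight K n)"
        by (simp add: power_mult_distrib mult_ac)
    qed
  qed
  then have radius: "fps_conv_radius ?F = \<infinity>"
    unfolding fps_conv_radius_def by (intro conv_radius_inftyI'') simp
  show "(\<lambda>n. of_real (a n) * z ^ n) sums power_symbol a z"
    using sums_eval_fps[of z ?F] radius by (simp add: power_symbol_def)
  have holo: "power_symbol a holomorphic_on UNIV"
    unfolding power_symbol_def using radius by (intro holomorphic_on_eval_fps) (auto simp: eball_def)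
  note deriv = higher_deriv_eval_fps[OF radius, folded power_symbol_def, simplified]
  have \<sigma>': "cmod (of_int \<sigma> ^ n) = 1" for n
    using \<sigma> by (simp add: norm_power flip: of_int_abs)
  have "coeff_bound K (\<lambda>n. (deriv ^^ n) (power_symbol a) 0 / fact n)"
  proof -
    have "(deriv ^^ n) (power_symbol a) 0 / fact n = of_real (a n)" for n
      using fps_nth_fps_expansion[OF eval_fps_has_fps_expansion, of ?F n] radius
      by (simp add: power_symbol_def)
    then show ?thesis using a by simp
  qed
  then have "coeff_bound K (taylor_coeff (\<lambda>z. power_symbol a (of_int \<sigma> * z)))"
    using taylor_coeff_affine[OF holo, of "of_int \<sigma>" 0]
    by (elim coeff_bound_mono) (simp add: norm_mult norm_divide \<sigma>')
  moreover have "(\<lambda>z. power_symbol a (of_int \<sigma> * z)) holomorphic_on UNIV"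
    using holomorphic_on_compose_gen[OF _ holo, of "\<lambda>z. of_int \<sigma> * z" UNIV]
    by (simp add: o_def holomorphic_intros)
  ultimately show "ultra_symbol K (\<lambda>z. power_symbol a (of_int \<sigma> * z))"
    by (simp add: ultra_symbol_iff)
  have "coeff_bound K (\<lambda>n. (deriv ^^ n) (power_symbol a) 1 / fact n)"
  proof (rule coeff_bound_shift[OF pos M1 M0 one a])
    fix j
    have "of_nat ((n + j) choose j) * complex_of_real (a (n + j)) =
        fact (n + j) * of_real (a (n + j)) / fact n / fact j" for n
      by (simp add: binomial_fact mult_ac)
    with sums_divide[OF deriv[of j 1], of "fact j"]
    show "(\<lambda>n. of_nat ((n + j) choose j) * complex_of_real (a (n + j))) sums
        ((deriv ^^ j) (power_symbol a) 1 / fact j)"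
      by simp
  qed
  then have "coeff_bound K (taylor_coeff (\<lambda>z. power_symbol a (of_int \<sigma> * z + 1)))"
    using taylor_coeff_affine[OF holo, of "of_int \<sigma>" 1]
    by (elim coeff_bound_mono) (simp add: norm_mult norm_divide \<sigma>')
  moreover have "(\<lambda>z. power_symbol a (of_int \<sigma> * z + 1)) holomorphic_on UNIV"
    using holomorphic_on_compose_gen[OF _ holo, of "\<lambda>z. of_int \<sigma> * z + 1" UNIV]
    by (simp add: o_def holomorphic_intros)
  ultimately show "ultra_symbol K (\<lambda>z. power_symbol a (of_int \<sigma> * z + 1))"
    by (simp add: ultra_symbol_iff)
qed

text \<open>All terms are positive, so each is a lower bound for the sum. Varying \<open>m\<close>
  gives estimates for all derivatives at once, and \<open>m = 0\<close> excludes zeros.\<close>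

lemma power_symbol_ge:
  assumes sums: "\<And>z. (\<lambda>n. of_real (a n) * z ^ n) sums power_symbol a z" and pos: "\<And>n. a n > 0"
    and "x > 0"
  shows "a m * x ^ m \<le> cmod (power_symbol a (of_real x))" "power_symbol a (of_real x) \<noteq> 0"
proof -
  have s: "(\<lambda>n. a n * x ^ n) sums Re (power_symbol a (of_real x))"
    using sums_Re[OF sums[of "of_real x"]] by (simp flip: of_real_power of_real_mult)
  have "sum (\<lambda>n. a n * x ^ n) {m} \<le> (\<Sum>n. a n * x ^ n)" for m
    using s pos \<open>x > 0\<close> by (intro sum_le_suminf) (auto simp: sums_iff less_imp_le)
  with sums_unique[OF s] have *: "a m * x ^ m \<le> cmod (power_symbol a (of_real x))" for m
    using complex_Re_le_cmod[of "power_symbol a (of_real x)"] by (fastforce intro: order_trans)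
  show "a m * x ^ m \<le> cmod (power_symbol a (of_real x))" by (rule *)
  show "power_symbol a (of_real x) \<noteq> 0" using *[of 0] pos[of 0] by auto
qed

section \<open>Impossibility\<close>

lemma geometric_functional_regularization:
  fixes a :: "nat \<Rightarrow> real"
  assumes posK: "\<And>p. weight K p > 0" and M1: "cond_M1 (weight K)" and M2: "cond_M2 (weight K)"
    and M0: "weight K 0 = 1" and one: "dominates_one K"
    and a: "coeff_bound K (\<lambda>n. of_real (a n))" and apos: "\<And>n. a n > 0"
    and posJ: "\<And>p. weight J p > 0" and dec: "decay J (\<lambda>p. 1 / a (p + 2))"
    and \<sigma>: "\<bar>\<sigma>\<bar> = (1::int)"
  obtains P f where "ultra_symbol K P" "ultra_symbol K (\<lambda>z. P (z + of_int \<sigma>))" "f \<in> E_space J"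
    "op_dual K (\<lambda>z. P (z + of_int \<sigma>)) (fun_functional K f) = geometric_functional K \<sigma>"
    "op_dual K P (fun_functional K (\<lambda>t. expi \<sigma> t * f t)) =
       (\<lambda>\<phi>. geometric_functional K \<sigma> \<phi> + - 1 * fun_functional K (\<lambda>t. 1) \<phi>)"
proof -
  define Q where "Q = power_symbol a"
  define P where "P z = Q (of_int \<sigma> * z)" for z
  define c where "c n = 1 / Q (of_real (real n + 1))" for n
  define f where "f = trig_series (\<lambda>n. \<sigma> * int n) c"
  have \<sigma>\<sigma>: "\<sigma> * \<sigma> = 1" using \<sigma> by (auto simp: abs_if split: if_splits)
  then have \<sigma>c: "of_int \<sigma> * of_int \<sigma> = (1::complex)" by (metis of_int_1 of_int_mult)
  have shift: "(\<lambda>z. P (z + of_int \<sigma>)) = (\<lambda>z. Q (of_int \<sigma> * z + 1))"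
    by (simp add: P_def distrib_left \<sigma>c)
  have P: "ultra_symbol K P"
    using ultra_symbol_power_symbol[OF posK M1 M0 one a \<sigma>] by (simp add: P_def[abs_def] Q_def)
  have P': "ultra_symbol K (\<lambda>z. P (z + of_int \<sigma>))"
    using ultra_symbol_power_symbol_shift[OF posK M1 M0 one a \<sigma>] by (simp add: shift Q_def)
  have sums: "(\<lambda>n. of_real (a n) * z ^ n) sums Q z" for z
    unfolding Q_def by (rule power_symbol_sums[OF posK M1 M0 one a \<sigma>])
  note ge = power_symbol_ge[OF sums[unfolded Q_def] apos, folded Q_def]
  have Qnz: "Q (of_real (real n + 1)) \<noteq> 0" for n by (rule ge(2)) simp
  have PQ: "P (of_int (\<sigma> * int n + \<sigma>)) = Q (of_real (real n + 1))" for n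
  proof -
    have "of_int \<sigma> * of_int (\<sigma> * int n + \<sigma>) = complex_of_real (real n + 1)"
      by (simp add: distrib_left \<sigma>c flip: mult.assoc)
    then show ?thesis by (simp only: P_def)
  qed
  have abs: "\<bar>of_int (\<sigma> * int n)\<bar> = real n" for n
    using \<sigma> by (simp add: abs_mult flip: of_int_abs)
  \<comment> \<open>Taking the term of index \<open>p + 2\<close> leaves
    \<open>1 / (n + 1)\<^sup>2\<close> after \<open>p\<close> powers are spent on the derivative, so
    the bound is summable in \<open>n\<close>.\<close>
  have cle: "cmod (c n) * \<bar>of_int (\<sigma> * int n)\<bar> ^ p \<le> 1 / a (p + 2) * (1 / (real n + 1)\<^sup>2)" for n p
  proof -
    let ?Q = "cmod (Q (of_real (real n + 1)))"
    have Q: "a (p + 2) * (real n + 1) ^ (p + 2) \<le> ?Q" by (rule ge(1)) simp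
    have pos: "0 < a (p + 2) * (real n + 1) ^ (p + 2)" using apos by simp
    have "cmod (c n) * \<bar>of_int (\<sigma> * int n)\<bar> ^ p = real n ^ p / ?Q"
      by (simp only: c_def abs norm_divide norm_one times_divide_eq_left mult_1)
    also have "\<dots> \<le> (real n + 1) ^ p / (a (p + 2) * (real n + 1) ^ (p + 2))"
      using Q pos by (intro frac_le power_mono) auto
    also have "\<dots> = 1 / a (p + 2) * (1 / (real n + 1)\<^sup>2)"
      using apos[of "p + 2"] by (simp add: power_add power2_eq_square)
    finally show ?thesis .
  qed
  have csum: "summable (\<lambda>n. cmod (c n) * \<bar>of_int (\<sigma> * int n)\<bar> ^ p)" for p
    by (rule summable_comparison_test'[OF summable_mult[OF summable_inverse_Suc_square, of "1 / a (p + 2)"]])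
      (use cle[of _ p] in simp)
  have fJ: "f \<in> E_space J"
    unfolding E_space_iff[OF posJ]
  proof
    show "f \<in> smooth_periodic" unfolding f_def by (rule smooth_periodic_trig_series[OF csum])
    show "decay J (\<lambda>p. Dsup p f)"
    proof (rule decay_cmult_mono[OF dec])
      fix p
      have "Dsup p f \<le> (\<Sum>n. cmod (c n) * \<bar>of_int (\<sigma> * int n)\<bar> ^ p)"
        unfolding f_def by (rule Dsup_trig_series[OF csum])
      also have "\<dots> \<le> (\<Sum>n. 1 / a (p + 2) * (1 / (real n + 1)\<^sup>2))"
        by (intro suminf_le cle csum summable_mult summable_inverse_Suc_square)
      also have "\<dots> = (\<Sum>n. 1 / (real n + 1)\<^sup>2) * (1 / a (p + 2))"
        by (subst suminf_mult[OF summable_inverse_Suc_square]) simp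
      finally show "Dsup p f \<le> (\<Sum>n. 1 / (real n + 1)\<^sup>2) * (1 / a (p + 2))" .
      show "(\<Sum>n. 1 / (real n + 1)\<^sup>2) \<ge> 0"
        by (intro suminf_nonneg summable_inverse_Suc_square) simp
    qed
  qed
  have csum0: "summable (\<lambda>n. cmod (c n))" using csum[of 0] by simp
  \<comment> \<open>One computation for both identities: frequencies \<open>\<sigma> * n\<close>
    with the translated symbol, and frequencies \<open>\<sigma> * n + \<sigma>\<close> with
    \<open>P\<close> itself. In both cases the multiplier is the denominator of \<open>c n\<close>,
    which it cancels.\<close>
  have pair: "fun_functional K (trig_series \<kappa> c) (op_fun (\<lambda>z. R (- z)) \<phi>) = (\<Sum>n. fourier (\<kappa> n) \<phi>)"
    if R: "ultra_symbol K R" and \<phi>: "\<phi> \<in> E_space K" and eq: "\<And>n. R (of_int (\<kappa> n)) = Q (of_real (real n + 1))"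
    for R \<phi> \<kappa>
  proof -
    note E = op_fun_in_E_space[OF posK M2 R \<phi>]
    have "c n * fourier (\<kappa> n) (op_fun (\<lambda>z. R (- z)) \<phi>) = fourier (\<kappa> n) \<phi>" for n
      using Qnz[of n] by (simp only: fourier_op_fun[OF posK M2 R \<phi>] eq c_def) simp
    then have "(\<lambda>n. fourier (\<kappa> n) \<phi>) sums
        integral {0..2 * pi} (\<lambda>t. trig_series \<kappa> c t * op_fun (\<lambda>z. R (- z)) \<phi> t)"
      using integral_trig_series[OF csum0 E_space_smooth_periodic[OF E], of \<kappa>] by simp
    with E show ?thesis by (simp add: fun_functional_def sums_iff)
  qed
  have ef: "(\<lambda>t. expi \<sigma> t * f t) = trig_series (\<lambda>n. \<sigma> * int n + \<sigma>) c"
  proof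
    fix t
    have "summable (\<lambda>n. c n * expi (\<sigma> * int n) t)"
      by (rule summable_norm_cancel) (simp add: norm_mult csum0)
    from suminf_mult[OF this, of "expi \<sigma> t"]
    show "expi \<sigma> t * f t = trig_series (\<lambda>n. \<sigma> * int n + \<sigma>) c t"
      by (simp add: f_def trig_series_def expi_add[symmetric] mult_ac)
  qed
  show ?thesis
  proof (rule that[OF P P' fJ])
    show "op_dual K (\<lambda>z. P (z + of_int \<sigma>)) (fun_functional K f) = geometric_functional K \<sigma>"
    proof
      fix \<phi>
      show "op_dual K (\<lambda>z. P (z + of_int \<sigma>)) (fun_functional K f) \<phi> = geometric_functional K \<sigma> \<phi>"
      proof (cases "\<phi> \<in> E_space K")
        case True
        then show ?thesis
          using pair[OF P' True, of "\<lambda>n. \<sigma> * int n"] PQ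
          by (simp add: op_dual_def geometric_functional_def f_def)
      qed (simp add: op_dual_def geometric_functional_def)
    qed
    show "op_dual K P (fun_functional K (\<lambda>t. expi \<sigma> t * f t)) =
       (\<lambda>\<phi>. geometric_functional K \<sigma> \<phi> + - 1 * fun_functional K (\<lambda>t. 1) \<phi>)"
    proof
      fix \<phi>
      show "op_dual K P (fun_functional K (\<lambda>t. expi \<sigma> t * f t)) \<phi> =
          geometric_functional K \<sigma> \<phi> + - 1 * fun_functional K (\<lambda>t. 1) \<phi>"
      proof (cases "\<phi> \<in> E_space K")
        case True
        have "summable (\<lambda>n. fourier (\<sigma> * int n) \<phi>)"
          by (rule summable_norm_cancel[OF summable_fourier[OF \<sigma> E_space_smooth_periodic[OF True]]])
        \<comment> \<open>The frequencies now start at \<sigma>, so the term of frequency 0 is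
          missing; it is the pairing with the constant function 1.\<close>
        from suminf_split_head[OF this]
        have "(\<Sum>n. fourier (\<sigma> * int n + \<sigma>) \<phi>) = (\<Sum>n. fourier (\<sigma> * int n) \<phi>) - fourier 0 \<phi>"
          by (simp add: distrib_left add.commute)
        then show ?thesis
          using True pair[OF P True, of "\<lambda>n. \<sigma> * int n + \<sigma>"] PQ
          by (simp add: op_dual_def geometric_functional_def ef fun_functional_def fourier_def expi_0)
      qed (simp add: op_dual_def geometric_functional_def fun_functional_def)
    qed
  qed
qed

text \<open>Isolates what depends on the pair of classes, namely the coefficients \<open>a\<close>.
  The last two hypotheses supply the constant test function in the class of \<open>K\<close> and the
  exponentials in the class of \<open>J\<close>.\<close>

lemma not_optimal_algebra:
  fixes a :: "nat \<Rightarrow> real" and \<Lambda> :: "(complex, 'a) module"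
  assumes posK: "\<And>p. weight K p > 0" and M1: "cond_M1 (weight K)" and M2: "cond_M2 (weight K)"
    and M0: "weight K 0 = 1" and one: "dominates_one K"
    and a: "coeff_bound K (\<lambda>n. of_real (a n))" and apos: "\<And>n. a n > 0"
    and posJ: "\<And>p. weight J p > 0" and dec: "decay J (\<lambda>p. 1 / a (p + 2))"
    and oneK: "decay K (\<lambda>_. 1)" and oneJ: "decay J (\<lambda>_. 1)"
  shows "\<not> optimal_algebra K J \<Lambda>"
proof
  assume "optimal_algebra K J \<Lambda>"
  then obtain \<iota> T where alg: "Module.algebra complex_ring \<Lambda>"
    and emb: "linear_embedding K \<Lambda> \<iota>" and unit: "\<iota> (fun_functional K (\<lambda>t. 1)) = \<one>\<^bsub>\<Lambda>\<^esub>"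
    and T_exp: "\<And>P k f. ultra_symbol K P \<Longrightarrow> f \<in> carrier \<Lambda> \<Longrightarrow>
              T P (\<iota> (fun_functional K (expi k)) \<otimes>\<^bsub>\<Lambda>\<^esub> f) =
              \<iota> (fun_functional K (expi k)) \<otimes>\<^bsub>\<Lambda>\<^esub> T (\<lambda>z. P (z + of_int k)) f"
    and T_\<iota>: "\<And>P u. ultra_symbol K P \<Longrightarrow> u \<in> E_dual K \<Longrightarrow> T P (\<iota> u) = \<iota> (op_dual K P u)"
    and prod: "\<And>f g. f \<in> E_space J \<Longrightarrow> g \<in> E_space J \<Longrightarrow>
           \<iota> (fun_functional K f) \<otimes>\<^bsub>\<Lambda>\<^esub> \<iota> (fun_functional K g) =
           \<iota> (fun_functional K (\<lambda>t. f t * g t))"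
    unfolding optimal_algebra_def by blast
  interpret cring \<Lambda> using alg by (rule algebra.axioms)
  let ?F = "fun_functional K" and ?G = "geometric_functional K"
  have \<iota>_closed: "\<iota> u \<in> carrier \<Lambda>" if "u \<in> E_dual K" for u
    using emb that by (auto simp: linear_embedding_def)
  have \<iota>_add: "\<iota> (\<lambda>\<phi>. u \<phi> + v \<phi>) = \<iota> u \<oplus>\<^bsub>\<Lambda>\<^esub> \<iota> v" if "u \<in> E_dual K" "v \<in> E_dual K" for u v
    using emb that by (auto simp: linear_embedding_def)
  have cont: "continuous_on {0..2 * pi} f" if "f \<in> E_space J" for f
    using continuous_Dop[OF E_space_smooth_periodic[OF that], of _ 0] by simp
  have F: "?F f \<in> E_dual K" if "f \<in> E_space J" for f
    by (intro fun_functional_in_E_dual posK cont that)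
  have e: "expi k \<in> E_space J" if "\<bar>k\<bar> \<le> 1" for k
    by (intro expi_in_E_space posJ oneJ that)
  have F1: "?F (\<lambda>t. 1) \<in> E_dual K" using F[OF e[of 0]] by (simp add: expi_0)
  have G: "?G \<sigma> \<in> E_dual K" if "\<bar>\<sigma>\<bar> = 1" for \<sigma>
    by (intro geometric_functional_in_E_dual posK that)
  have geometric: "\<iota> (?G \<sigma>) = \<iota> (?F (expi \<sigma>)) \<otimes>\<^bsub>\<Lambda>\<^esub> \<iota> (?G \<sigma>) \<oplus>\<^bsub>\<Lambda>\<^esub> \<one>\<^bsub>\<Lambda>\<^esub>" if \<sigma>: "\<bar>\<sigma>\<bar> = 1" for \<sigma>
  proof -
    obtain P f where P: "ultra_symbol K P" "ultra_symbol K (\<lambda>z. P (z + of_int \<sigma>))" and f: "f \<in> E_space J"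
      and Pf: "op_dual K (\<lambda>z. P (z + of_int \<sigma>)) (?F f) = ?G \<sigma>"
      and Pef: "op_dual K P (?F (\<lambda>t. expi \<sigma> t * f t)) = (\<lambda>\<phi>. ?G \<sigma> \<phi> + - 1 * ?F (\<lambda>t. 1) \<phi>)"
      by (rule geometric_functional_regularization[OF posK M1 M2 M0 one a apos posJ dec \<sigma>])
    let ?u = "\<lambda>\<phi>. ?G \<sigma> \<phi> + - 1 * ?F (\<lambda>t. 1) \<phi>"
    have ef: "?F (\<lambda>t. expi \<sigma> t * f t) \<in> E_dual K"
      by (intro fun_functional_in_E_dual posK continuous_intros cont f)
    have u: "?u \<in> E_dual K"
      by (intro E_dual_add_cmult G F1 \<sigma>)
    \<comment> \<open>The same element is computed by the usual action of \<open>P(D)\<close> on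
      ultradistributions and by the commutation rule in the algebra, after splitting the product
      inside the class of \<open>J\<close>.\<close>
    have "\<iota> ?u = T P (\<iota> (?F (\<lambda>t. expi \<sigma> t * f t)))"
      by (simp only: T_\<iota>[OF P(1) ef] Pef)
    also have "\<dots> = T P (\<iota> (?F (expi \<sigma>)) \<otimes>\<^bsub>\<Lambda>\<^esub> \<iota> (?F f))"
      using prod[OF e f, of \<sigma>] \<sigma> by simp
    also have "\<dots> = \<iota> (?F (expi \<sigma>)) \<otimes>\<^bsub>\<Lambda>\<^esub> \<iota> (?G \<sigma>)"
      by (simp only: T_exp[OF P(1) \<iota>_closed[OF F[OF f]]] T_\<iota>[OF P(2) F[OF f]] Pf)
    finally have "\<iota> ?u = \<iota> (?F (expi \<sigma>)) \<otimes>\<^bsub>\<Lambda>\<^esub> \<iota> (?G \<sigma>)" .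
    moreover have "\<iota> (?G \<sigma>) = \<iota> ?u \<oplus>\<^bsub>\<Lambda>\<^esub> \<one>\<^bsub>\<Lambda>\<^esub>"
      using \<iota>_add[OF u F1] by (simp add: unit)
    ultimately show ?thesis by simp
  qed
  define x y v w where "x = \<iota> (?F (expi 1))" and "y = \<iota> (?F (expi (- 1)))"
    and "v = \<iota> (?G 1)" and "w = \<iota> (?G (- 1))"
  have closed: "x \<in> carrier \<Lambda>" "y \<in> carrier \<Lambda>" "v \<in> carrier \<Lambda>" "w \<in> carrier \<Lambda>"
    unfolding x_def y_def v_def w_def by (intro \<iota>_closed F e G; simp)+
  have v: "v = x \<otimes>\<^bsub>\<Lambda>\<^esub> v \<oplus>\<^bsub>\<Lambda>\<^esub> \<one>\<^bsub>\<Lambda>\<^esub>" and w: "w = y \<otimes>\<^bsub>\<Lambda>\<^esub> w \<oplus>\<^bsub>\<Lambda>\<^esub> \<one>\<^bsub>\<Lambda>\<^esub>"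
    unfolding x_def y_def v_def w_def by (rule geometric; simp)+
  have xy: "x \<otimes>\<^bsub>\<Lambda>\<^esub> y = \<one>\<^bsub>\<Lambda>\<^esub>"
    unfolding x_def y_def using prod[OF e e, of 1 "- 1"] by (simp add: expi_add expi_0 unit)
  \<comment> \<open>Associativity allows the product of the two inverses to be expanded through
    either factor: \<open>p = x p + w\<close> and \<open>p = y p + v\<close>. Multiplying the second
    by \<open>x\<close> and using \<open>x y = 1\<close> gives \<open>x p = p + x v\<close>;
    comparison with the first leaves \<open>x v + w = 0\<close>, where
    \<open>x v = v - 1\<close>.\<close>
  define p where "p = v \<otimes>\<^bsub>\<Lambda>\<^esub> w"
  have p: "p \<in> carrier \<Lambda>" unfolding p_def by (intro m_closed closed)
  have "p = (x \<otimes>\<^bsub>\<Lambda>\<^esub> v \<oplus>\<^bsub>\<Lambda>\<^esub> \<one>\<^bsub>\<Lambda>\<^esub>) \<otimes>\<^bsub>\<Lambda>\<^esub> w"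
    unfolding p_def using v by simp
  then have p1: "p = x \<otimes>\<^bsub>\<Lambda>\<^esub> p \<oplus>\<^bsub>\<Lambda>\<^esub> w"
    unfolding p_def using closed by (simp add: l_distr m_assoc)
  have "p = v \<otimes>\<^bsub>\<Lambda>\<^esub> (y \<otimes>\<^bsub>\<Lambda>\<^esub> w \<oplus>\<^bsub>\<Lambda>\<^esub> \<one>\<^bsub>\<Lambda>\<^esub>)"
    unfolding p_def using w by simp
  also have "\<dots> = v \<otimes>\<^bsub>\<Lambda>\<^esub> (y \<otimes>\<^bsub>\<Lambda>\<^esub> w) \<oplus>\<^bsub>\<Lambda>\<^esub> v"
    using closed by (simp add: r_distr)
  also have "v \<otimes>\<^bsub>\<Lambda>\<^esub> (y \<otimes>\<^bsub>\<Lambda>\<^esub> w) = y \<otimes>\<^bsub>\<Lambda>\<^esub> p"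
    unfolding p_def by (rule m_lcomm) (rule closed)+
  finally have p2: "p = y \<otimes>\<^bsub>\<Lambda>\<^esub> p \<oplus>\<^bsub>\<Lambda>\<^esub> v" .
  have "x \<otimes>\<^bsub>\<Lambda>\<^esub> p = x \<otimes>\<^bsub>\<Lambda>\<^esub> (y \<otimes>\<^bsub>\<Lambda>\<^esub> p \<oplus>\<^bsub>\<Lambda>\<^esub> v)"
    using p2 by simp
  also have "\<dots> = p \<oplus>\<^bsub>\<Lambda>\<^esub> x \<otimes>\<^bsub>\<Lambda>\<^esub> v"
    using closed p by (simp add: r_distr m_assoc[symmetric] xy)
  finally have "p \<oplus>\<^bsub>\<Lambda>\<^esub> \<zero>\<^bsub>\<Lambda>\<^esub> = p \<oplus>\<^bsub>\<Lambda>\<^esub> (x \<otimes>\<^bsub>\<Lambda>\<^esub> v \<oplus>\<^bsub>\<Lambda>\<^esub> w)"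
    using p1 closed p by (simp add: a_assoc)
  then have zero: "\<zero>\<^bsub>\<Lambda>\<^esub> = x \<otimes>\<^bsub>\<Lambda>\<^esub> v \<oplus>\<^bsub>\<Lambda>\<^esub> w"
    using closed p by (simp only: add.l_cancel m_closed a_closed zero_closed)
  have "v \<oplus>\<^bsub>\<Lambda>\<^esub> w = (x \<otimes>\<^bsub>\<Lambda>\<^esub> v \<oplus>\<^bsub>\<Lambda>\<^esub> \<one>\<^bsub>\<Lambda>\<^esub>) \<oplus>\<^bsub>\<Lambda>\<^esub> w"
    using v by simp
  also have "\<dots> = (x \<otimes>\<^bsub>\<Lambda>\<^esub> v \<oplus>\<^bsub>\<Lambda>\<^esub> w) \<oplus>\<^bsub>\<Lambda>\<^esub> \<one>\<^bsub>\<Lambda>\<^esub>"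
    using closed by (simp add: a_ac)
  also have "\<dots> = \<one>\<^bsub>\<Lambda>\<^esub>"
    unfolding zero[symmetric] by simp
  finally have "v \<oplus>\<^bsub>\<Lambda>\<^esub> w = \<one>\<^bsub>\<Lambda>\<^esub>" .
  then have "\<iota> (\<lambda>\<phi>. ?G 1 \<phi> + ?G (- 1) \<phi>) = \<iota> (?F (\<lambda>t. 1))"
    unfolding v_def w_def using \<iota>_add[OF G G, of 1 "- 1"] unit by simp
  moreover have "inj_on \<iota> (E_dual K)" using emb by (simp add: linear_embedding_def)
  moreover have "(\<lambda>\<phi>. ?G 1 \<phi> + ?G (- 1) \<phi>) \<in> E_dual K"
    using E_dual_add_cmult[OF G G, of 1 "- 1" 1] by simp
  ultimately have "(\<lambda>\<phi>. ?G 1 \<phi> + ?G (- 1) \<phi>) = ?F (\<lambda>t. 1)"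
    using F1 by (meson inj_onD)
  \<comment> \<open>Testing on the constant function separates the two sides: each geometric series
    contributes \<open>2 * pi\<close> from its zero frequency, so the left side is twice the right
    one.\<close>
  then have "?G 1 (expi 0) + ?G (- 1) (expi 0) = ?F (expi 0) (expi 0)"
    by (simp add: expi_0 fun_eq_iff)
  moreover have E: "expi 0 \<in> E_space K" by (rule expi_in_E_space[OF posK oneK]) simp
  then have "?F (expi 0) (expi 0) = 2 * pi"
    using fourier_expi[of 0 0] by (simp add: fun_functional_def fourier_def)
  moreover have "?G \<sigma> (expi 0) = 2 * pi" if "\<bar>\<sigma>\<bar> = 1" for \<sigma>
  proof -
    have "\<sigma> \<noteq> 0" using that by auto
    then have "(\<lambda>n. fourier (\<sigma> * int n) (expi 0)) =
        (\<lambda>n. if n = 0 then complex_of_real (2 * pi) else 0)"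
      by (auto simp: fourier_expi)
    moreover have "(\<lambda>n. if n = 0 then complex_of_real (2 * pi) else 0) sums (2 * pi)"
      using sums_single[of 0 "\<lambda>n. complex_of_real (2 * pi)"] by simp
    ultimately show ?thesis
      using E by (simp add: geometric_functional_def sums_iff)
  qed
  from this[of 1] this[of "- 1"] calculation have "complex_of_real (2 * pi) + of_real (2 * pi) = of_real (2 * pi)"
    by simp
  then show False by simp
qed

section \<open>Comparison of weight sequences and choice of coefficients\<close>

lemma seq_prec_shift:
  assumes M2: "cond_M2 M" and pos: "\<And>p. M p > 0" "\<And>p. N p > 0" and prec: "seq_prec M N"
  shows "seq_prec (\<lambda>p. M (p + q)) N"
  unfolding seq_prec_def
proof (intro allI impI)
  fix h :: real assume "h > 0"
  obtain A H where AH: "A \<ge> 1" "H \<ge> 1" "\<And>p q. M (p + q) \<le> A * H ^ (p + q) * M p * M q"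
    using M2 unfolding cond_M2_def by blast
  \<comment> \<open>Aiming at \<open>h / H\<close> prepays the factor \<open>H ^ p\<close> that
    (M.2) charges for the shift.\<close>
  have "h / H > 0" using \<open>h > 0\<close> AH by simp
  with prec obtain C where C: "C > 0" "\<And>p. M p \<le> C * (h / H) ^ p * N p"
    unfolding seq_prec_def by blast
  have "M (p + q) \<le> A * H ^ q * M q * C * h ^ p * N p" for p
  proof -
    have "M (p + q) \<le> (A * H ^ (p + q) * M q) * M p"
      using AH(3)[of p q] by (simp add: mult_ac)
    also have "\<dots> \<le> (A * H ^ (p + q) * M q) * (C * (h / H) ^ p * N p)"
      using AH pos(1)[of q] C by (intro mult_left_mono) auto
    also have "\<dots> = A * H ^ q * M q * C * h ^ p * N p"
      using AH by (simp add: power_add power_divide)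
    finally show ?thesis .
  qed
  moreover have "A * H ^ q * M q * C > 0" using AH pos C by simp
  ultimately show "\<exists>C>0. \<forall>p. M (p + q) \<le> C * h ^ p * N p" by blast
qed

lemma decay_Beurling:
  assumes "seq_prec b N"
  shows "decay (Beurling N) b"
  unfolding decay.simps
proof (intro allI impI)
  fix h :: real assume "h > 0"
  then have "1 / h > 0" by simp
  with assms obtain C where "\<And>p. b p \<le> C * (1 / h) ^ p * N p"
    unfolding seq_prec_def by blast
  with \<open>h > 0\<close> have "h ^ p * b p \<le> C * N p" for p
    by (simp add: power_divide pos_le_divide_eq mult.commute)
  then show "\<exists>C. \<forall>p. h ^ p * b p \<le> C * N p" by blast
qed

lemma seq_prec_imp_seq_sub: "seq_prec M N \<Longrightarrow> seq_sub M N"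
  unfolding seq_prec_def seq_sub_def using zero_less_one by blast

lemma seq_sub_prec_trans:
  assumes "seq_sub L M" "seq_prec M N" "\<And>p. M p > 0"
  shows "seq_prec L N"
  unfolding seq_prec_def
proof (intro allI impI)
  fix k :: real assume "k > 0"
  obtain C h where C: "C > 0" "h > 0" "\<And>p. L p \<le> C * h ^ p * M p"
    using assms(1) unfolding seq_sub_def by blast
  have "k / h > 0" using \<open>k > 0\<close> C by simp
  with assms(2) obtain D where D: "D > 0" "\<And>p. M p \<le> D * (k / h) ^ p * N p"
    unfolding seq_prec_def by blast
  have "L p \<le> C * D * k ^ p * N p" for p
  proof -
    have "C * h ^ p * M p \<le> C * h ^ p * (D * (k / h) ^ p * N p)"
      using C D by (intro mult_left_mono) auto
    also have "\<dots> = C * D * k ^ p * N p" using C by (simp add: power_divide)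
    finally show ?thesis using C(3)[of p] by linarith
  qed
  moreover have "C * D > 0" using C D by simp
  ultimately show "\<exists>C>0. \<forall>p. L p \<le> C * k ^ p * N p" by blast
qed

lemma decay_Roumieu:
  assumes "seq_sub b M"
  shows "decay (Roumieu M) b"
proof -
  obtain C h where C: "h > 0" "\<And>p. b p \<le> C * h ^ p * M p"
    using assms unfolding seq_sub_def by blast
  then have "(1 / h) ^ p * b p \<le> C * M p" for p
    by (simp add: power_divide pos_divide_le_eq mult_ac)
  moreover have "1 / h > 0" using C by simp
  ultimately show ?thesis unfolding decay.simps by blast
qed

text \<open>For fixed \<open>q\<close>, (M.2) bounds the shift by a geometric factor, which the
  relation tolerates. This is what places \<open>f\<close> in the Roumieu class of \<open>M\<close>
  itself.\<close>

lemma seq_sub_shift: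
  assumes M2: "cond_M2 M" and pos: "\<And>p. M p > 0"
  shows "seq_sub (\<lambda>p. M (p + q)) M"
proof -
  obtain A H where AH: "A \<ge> 1" "H \<ge> 1" "\<And>p q. M (p + q) \<le> A * H ^ (p + q) * M p * M q"
    using M2 unfolding cond_M2_def by blast
  have "M (p + q) \<le> A * H ^ q * M q * H ^ p * M p" for p
    using AH(3)[of p q] by (simp add: power_add mult_ac)
  moreover have "A * H ^ q * M q > 0" "H > 0" using AH pos by auto
  ultimately show ?thesis unfolding seq_sub_def by blast
qed

lemma coeff_bound_Beurling_inverse:
  assumes "\<And>p. M p > 0"
  shows "coeff_bound (Beurling M) (\<lambda>n. of_real (1 / M n))"
  unfolding coeff_bound.simps
  by (rule exI[of _ 1], rule conjI[OF zero_less_one], rule exI[of _ 1])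
    (use assms in \<open>simp add: norm_divide less_imp_le\<close>)

text \<open>Interpolating between \<open>M\<close> and \<open>N\<close> leaves room for the Roumieu bound. The index of \<open>N\<close> is
  shifted because \<open>N\<close> need not satisfy (M.2).\<close>

lemma coeff_bound_Roumieu_sqrt:
  assumes pos: "\<And>p. M p > 0" "\<And>p. N p > 0" and prec: "seq_prec (\<lambda>p. M (p + 2)) N"
  shows "coeff_bound (Roumieu M) (\<lambda>n. of_real (1 / sqrt (M n * N (n - 2))))"
  unfolding coeff_bound.simps
proof (intro allI impI)
  fix L :: real assume "L > 0"
  then have "L\<^sup>2 > 0" by simp
  with prec obtain C where C: "C > 0" "\<And>p. M (p + 2) \<le> C * (L\<^sup>2) ^ p * N p"
    unfolding seq_prec_def by blast
  \<comment> \<open>One summand for each case below. For \<open>n = p + 2\<close> the power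
    \<open>(L\<^sup>2) ^ p\<close> is \<open>(L ^ n)\<^sup>2 / L ^ 4\<close>; for
    \<open>n = 0\<close> and \<open>n = 1\<close> the truncated index \<open>n - 2\<close> is
    0.\<close>
  define D where "D = C / L ^ 4 + M 0 / N 0 + M 1 / (N 0 * L\<^sup>2)"
  have D: "D > 0" "C / L ^ 4 \<le> D" "M 0 / N 0 \<le> D" "M 1 / (N 0 * L\<^sup>2) \<le> D"
    using C \<open>L > 0\<close> pos[of 0] pos(1)[of 1] by (auto simp: D_def intro!: add_pos_pos)
  have le: "M n \<le> D * (L ^ n)\<^sup>2 * N (n - 2)" for n
  proof -
    consider "n = 0" | "n = 1" | p where "n = p + 2"
      by (metis One_nat_def Suc_eq_plus1 add_2_eq_Suc' not0_implies_Suc)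
    then show ?thesis
    proof cases
      case 1
      then show ?thesis using D(3) pos(2)[of 0] by (simp add: pos_divide_le_eq)
    next
      case 2
      then show ?thesis using D(4) pos(2)[of 0] \<open>L > 0\<close> by (simp add: pos_divide_le_eq mult_ac)
    next
      case 3
      have "M n \<le> C / L ^ 4 * (L ^ n)\<^sup>2 * N p"
        using C(2)[of p] \<open>L > 0\<close> 3 by (simp add: power_add power_mult_distrib eval_nat_numeral mult_ac flip: power_mult)
      also have "\<dots> \<le> D * (L ^ n)\<^sup>2 * N p"
        using D pos(2)[of p] by (intro mult_right_mono) auto
      finally show ?thesis using 3 by simp
    qed
  qed
  have "cmod (of_real (1 / sqrt (M n * N (n - 2)))) \<le> sqrt D * L ^ n / M n" for n
  proof -
    have pos': "0 < M n * N (n - 2)" using pos by simp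
    have "M n * M n \<le> M n * (D * (L ^ n)\<^sup>2 * N (n - 2))"
      using le[of n] pos(1)[of n] by (intro mult_left_mono) auto
    then have "(M n)\<^sup>2 \<le> D * (L ^ n)\<^sup>2 * (M n * N (n - 2))"
      by (simp add: power2_eq_square mult_ac)
    then have "sqrt ((M n)\<^sup>2) \<le> sqrt (D * (L ^ n)\<^sup>2 * (M n * N (n - 2)))"
      by (rule real_sqrt_le_mono)
    then have "M n \<le> sqrt D * L ^ n * sqrt (M n * N (n - 2))"
      using pos(1)[of n] \<open>L > 0\<close> by (simp add: real_sqrt_mult)
    then have "1 / sqrt (M n * N (n - 2)) \<le> sqrt D * L ^ n / M n"
      using pos(1)[of n] pos' by (simp add: pos_le_divide_eq pos_divide_le_eq mult_ac)
    moreover have "cmod (of_real (1 / sqrt (M n * N (n - 2)))) = 1 / sqrt (M n * N (n - 2))"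
      using pos' by (simp only: norm_of_real) simp
    ultimately show ?thesis by simp
  qed
  moreover have "sqrt D > 0" using D by simp
  ultimately show "\<exists>C>0. \<forall>n. cmod (of_real (1 / sqrt (M n * N (n - 2)))) \<le> C * L ^ n / M n" by blast
qed

text \<open>The quotient of the geometric mean by \<open>N\<close> is the square root of
  \<open>M / N\<close>, so applying the hypothesis with \<open>h\<^sup>2\<close> yields
  \<open>h\<close>.\<close>

lemma seq_prec_sqrt:
  assumes pos: "\<And>p. M p > 0" "\<And>p. N p > 0" and prec: "seq_prec M N"
  shows "seq_prec (\<lambda>p. sqrt (M p * N p)) N"
  unfolding seq_prec_def
proof (intro allI impI)
  fix h :: real assume "h > 0"
  then have "h\<^sup>2 > 0" by simp
  with prec obtain C where C: "C > 0" "\<And>p. M p \<le> C * (h\<^sup>2) ^ p * N p"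
    unfolding seq_prec_def by blast
  have "sqrt (M p * N p) \<le> sqrt C * h ^ p * N p" for p
  proof (rule real_le_lsqrt)
    have "M p * N p \<le> (C * (h\<^sup>2) ^ p * N p) * N p"
      using C(2) pos(2)[of p] by (intro mult_right_mono) auto
    also have "\<dots> = (sqrt C * h ^ p * N p)\<^sup>2"
      using C(1) by (simp add: power_mult_distrib power2_eq_square[of "N p"] power_even_eq flip: power_mult) 
    finally show "M p * N p \<le> (sqrt C * h ^ p * N p)\<^sup>2" .
  qed (use C \<open>h > 0\<close> pos(2)[of p] in simp)
  moreover have "sqrt C > 0" using C by simp
  ultimately show "\<exists>C>0. \<forall>p. sqrt (M p * N p) \<le> C * h ^ p * N p" by blast
qed

theorem theorem2:
  fixes M N :: "nat \<Rightarrow> real"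
  assumes M_pos: "\<And>p. M p > 0" and M_0: "M 0 = 1" and M_1: "cond_M1 M" and M_2: "cond_M2 M"
    and N_pos: "\<And>p. N p > 0" and N_0: "N 0 = 1" and N_1: "cond_M1 N"
    and M_prec_N: "seq_prec M N"
  shows "(seq_prec (\<lambda>p. 1) M \<longrightarrow>
            \<not> (\<exists>\<Lambda> :: (complex, 'a) module. optimal_algebra (Beurling M) (Beurling N) \<Lambda>)) \<and>
         (seq_sub (\<lambda>p. 1) M \<longrightarrow>
            \<not> (\<exists>\<Lambda> :: (complex, 'a) module. optimal_algebra (Roumieu M) (Beurling N) \<Lambda>)) \<and>
         (seq_prec (\<lambda>p. 1) M \<longrightarrow>
            \<not> (\<exists>\<Lambda> :: (complex, 'a) module. optimal_algebra (Beurling M) (Roumieu M) \<Lambda>))"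
proof -
  have shift: "seq_prec (\<lambda>p. M (p + 2)) N"
    by (rule seq_prec_shift[OF M_2 M_pos N_pos M_prec_N])
  have "\<not> optimal_algebra (Beurling M) (Beurling N) \<Lambda>" if one: "seq_prec (\<lambda>p. 1) M"
    for \<Lambda> :: "(complex, 'a) module"
  proof (rule not_optimal_algebra[where a = "\<lambda>n. 1 / M n"])
    show "decay (Beurling N) (\<lambda>p. 1 / (1 / M (p + 2)))"
      using decay_Beurling[OF shift] by simp
    show "decay (Beurling N) (\<lambda>_. 1)"
      by (intro decay_Beurling seq_sub_prec_trans[OF seq_prec_imp_seq_sub[OF one] M_prec_N M_pos])
  qed (use assms one coeff_bound_Beurling_inverse[OF M_pos] decay_Beurling[OF one] in
      \<open>simp_all add: dominates_one_def del: decay.simps coeff_bound.simps\<close>)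
  moreover have "\<not> optimal_algebra (Roumieu M) (Beurling N) \<Lambda>" if one: "seq_sub (\<lambda>p. 1) M"
    for \<Lambda> :: "(complex, 'a) module"
  proof (rule not_optimal_algebra[where a = "\<lambda>n. 1 / sqrt (M n * N (n - 2))"])
    \<comment> \<open>At \<open>n = p + 2\<close> the index of \<open>N\<close> returns to
      \<open>p\<close>, so \<open>1 / a (p + 2)\<close> is the geometric mean of the shifted
      \<open>M\<close> and the unshifted \<open>N\<close>.\<close>
    show "decay (Beurling N) (\<lambda>p. 1 / (1 / sqrt (M (p + 2) * N (p + 2 - 2))))"
      using decay_Beurling[OF seq_prec_sqrt[OF M_pos N_pos shift]] by simp
    show "decay (Beurling N) (\<lambda>_. 1)"
      by (intro decay_Beurling seq_sub_prec_trans[OF one M_prec_N M_pos])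
  qed (use assms one coeff_bound_Roumieu_sqrt[OF M_pos N_pos shift] decay_Roumieu[OF one] in
      \<open>simp_all add: dominates_one_def del: decay.simps coeff_bound.simps\<close>)
  moreover have "\<not> optimal_algebra (Beurling M) (Roumieu M) \<Lambda>" if one: "seq_prec (\<lambda>p. 1) M"
    for \<Lambda> :: "(complex, 'a) module"
  proof (rule not_optimal_algebra[where a = "\<lambda>n. 1 / M n"])
    show "decay (Roumieu M) (\<lambda>p. 1 / (1 / M (p + 2)))"
      using decay_Roumieu[OF seq_sub_shift[OF M_2 M_pos, of 2]] by simp
  qed (use assms one coeff_bound_Beurling_inverse[OF M_pos] decay_Beurling[OF one]
        decay_Roumieu[OF seq_prec_imp_seq_sub[OF one]] in
      \<open>simp_all add: dominates_one_def del: decay.simps coeff_bound.simps\<close>)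
  ultimately show ?thesis by blast
qed

end
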